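(* Let $\Lambda$ be a sequence in $\mathbb{D}$ satisfying the Blaschke condition $\sum_{\lambda\in\Lambda}(1-|\lambda|)<\infty$. The following statements are equivalent: (a) $\Lambda$ is a free interpolating sequence for the Nevanlinna class $N$. (b) The trace space is given by $$N|\Lambda=l_N:=\{(a_\lambda)_{\lambda\in\Lambda}:\ \exists\, h\in \mathrm{Har}_+(\mathbb{D})\ \text{such that } h(\lambda)\ge\log^+|a_\lambda|,\ \lambda\in\Lambda\}.$$ (c) $\varphi_\Lambda$ admits a positive harmonic majorant. (d) There exists $C>0$ such that for any sequence of nonnegative numbers $(c_\lambda)_{\lambda\in\Lambda}$, $$\sum_{\lambda\in\Lambda}c_\lambda\varphi_\Lambda(\lambda)=\sum_{\lambda\in\Lambda}c_\lambda\log|B_\lambda(\lambda)|^{-1}\le C\sup_{\zeta\in\partial\mathbb{D}}\sum_{\lambda\in\Lambda}c_\lambda P_\lambda(\zeta)$$ (both sides being allowed to take the value $+\infty$).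
   Context: $\mathbb{D}$ is the open unit disc. A sequence $\Lambda\subset\mathbb{D}$ means a discrete sequence of (distinct) points of $\mathbb{D}$. The Nevanlinna class is $N=\{f\in\mathrm{Hol}(\mathbb{D}):\lim_{r\to1}\frac1{2\pi}\int_0^{2\pi}\log^+|f(re^{i\theta})|\,d\theta<\infty\}$. For a space $X$ of holomorphic functions on $\mathbb{D}$, the trace $X|\Lambda$ is the set of complex sequences $(f(\lambda))_{\lambda\in\Lambda}$, $f\in X$. A sequence space $l$ is ideal if $(a_\lambda)\in l$ and $(\omega_\lambda)\in\ell^\infty$ imply $(\omega_\lambda a_\lambda)\in l$. $\Lambda$ is free interpolating for $X$ if $X|\Lambda$ is ideal. For $\lambda\in\mathbb{D}$, $b_\lambda(z)=\frac{|\lambda|}{\lambda}\frac{\lambda-z}{1-\overline{\lambda}z}$ ($b_0(z)=z$). For $\lambda\in\Lambda$, $B_\lambda=\prod_{\lambda'\in\Lambda\setminus\{\lambda\}}b_{\lambda'}$. The function $\varphi_\Lambda:\mathbb{D}\to[0,\infty)$ is $\varphi_\Lambda(\lambda)=\log|B_\lambda(\lambda)|^{-1}$ for $\lambda\in\Lambda$ and $\varphi_\Lambda(z)=0$ for $z\notin\Lambda$. $\mathrm{Har}_+(\mathbb{D})$ is the set of positive harmonic functions on $\mathbb{D}$ (positive meaning $\ge 0$). A Borel function $\varphi$ on $\mathbb{D}$ admits a positive harmonic majorant if there is $h\in\mathrm{Har}_+(\mathbb{D})$ with $h(z)\ge\varphi(z)$ for all $z\in\mathbb{D}$. The Poisson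 kernel is $P_z(\zeta)=\frac{1-|z|^2}{|\zeta-z|^2}$, $z\in\mathbb{D}$, $\zeta\in\partial\mathbb{D}$. *)

theory Defs
  imports "HOL-Analysis.Analysis"
begin

abbreviation unit_disc :: "complex set" where
  "unit_disc \<equiv> ball 0 1"

(* ln 0 = 0 in HOL, so log_plus 0 = 0, as it should be. *)
definition log_plus :: "real \<Rightarrow> real" where
  "log_plus x = max 0 (ln x)"

(* The circular means are real numbers, nonnegative and nondecreasing in r, so "the limit
   is finite" is convergence to a real number. *)
definition nevanlinna_class :: "(complex \<Rightarrow> complex) set" where
  "nevanlinna_class =
     {f. f holomorphic_on unit_disc \<and>
         (\<exists>L::real. ((\<lambda>r. 1 / (2 * pi) *
            integral {0..2 * pi} (\<lambda>\<theta>. log_plus (cmod (f (of_real r * cis \<theta>))))) \<longlongrightarrow> L)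
            (at_left 1))}"

(* A sequence of distinct points is represented by the set \<Lambda> of its terms, and a family
   (a_\<lambda>) indexed by \<Lambda> by a function in "extensional \<Lambda>", so that equality of functions
   is equality of families. *)
definition trace_space :: "(complex \<Rightarrow> complex) set \<Rightarrow> complex set \<Rightarrow> (complex \<Rightarrow> complex) set" where
  "trace_space X \<Lambda> = (\<lambda>f. restrict f \<Lambda>) ` X"

definition ideal_space :: "complex set \<Rightarrow> (complex \<Rightarrow> complex) set \<Rightarrow> bool" where
  "ideal_space \<Lambda> l \<longleftrightarrow>
     (\<forall>a\<in>l. \<forall>\<omega>. bounded (\<omega> ` \<Lambda>) \<longrightarrow> (\<lambda>z\<in>\<Lambda>. \<omega> z * a z) \<in> l)"

definition free_interpolating :: "(complex \<Rightarrow> complex) set \<Rightarrow> complex set \<Rightarrow> bool" where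
  "free_interpolating X \<Lambda> \<longleftrightarrow> ideal_space \<Lambda> (trace_space X \<Lambda>)"

definition blaschke_factor :: "complex \<Rightarrow> complex \<Rightarrow> complex" where
  "blaschke_factor w z =
     (if w = 0 then z else of_real (cmod w) / w * ((w - z) / (1 - cnj w * z)))"

(* The unordered infinite product, i.e. the limit along the net of finite subproducts (the
   multiplicative counterpart of infsum). *)
definition blaschke_product_except :: "complex set \<Rightarrow> complex \<Rightarrow> complex \<Rightarrow> complex" where
  "blaschke_product_except \<Lambda> w z =
     Lim (finite_subsets_at_top (\<Lambda> - {w})) (\<lambda>F. \<Prod>v\<in>F. blaschke_factor v z)"

definition phi :: "complex set \<Rightarrow> complex \<Rightarrow> real" where
  "phi \<Lambda> z = (if z \<in> \<Lambda> then ln (inverse (cmod (blaschke_product_except \<Lambda> z z))) else 0)"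

(* h is C^2 on the set S (as a function of two real variables) with vanishing Laplacian:
   h' z and h'' z are the first and second Frechet derivatives of h at z. *)
definition harmonic_on :: "(complex \<Rightarrow> real) \<Rightarrow> complex set \<Rightarrow> bool" where
  "harmonic_on h S \<longleftrightarrow>
     (\<exists>(h' :: complex \<Rightarrow> complex \<Rightarrow>\<^sub>L real) (h'' :: complex \<Rightarrow> complex \<Rightarrow>\<^sub>L complex \<Rightarrow>\<^sub>L real).
        (\<forall>z\<in>S. (h has_derivative blinfun_apply (h' z)) (at z)) \<and>
        (\<forall>z\<in>S. (h' has_derivative blinfun_apply (h'' z)) (at z)) \<and>
        continuous_on S h'' \<and>
        (\<forall>z\<in>S. blinfun_apply (blinfun_apply (h'' z) 1) 1
              + blinfun_apply (blinfun_apply (h'' z) \<i>) \<i> = 0))"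

definition positive_harmonic :: "(complex \<Rightarrow> real) set" where
  "positive_harmonic = {h. harmonic_on h unit_disc \<and> (\<forall>z\<in>unit_disc. 0 \<le> h z)}"

definition has_positive_harmonic_majorant :: "(complex \<Rightarrow> real) \<Rightarrow> bool" where
  "has_positive_harmonic_majorant \<phi> \<longleftrightarrow>
     (\<exists>h\<in>positive_harmonic. \<forall>z\<in>unit_disc. \<phi> z \<le> h z)"

definition l_N :: "complex set \<Rightarrow> (complex \<Rightarrow> complex) set" where
  "l_N \<Lambda> = {a \<in> extensional \<Lambda>.
      \<exists>h\<in>positive_harmonic. \<forall>z\<in>\<Lambda>. log_plus (cmod (a z)) \<le> h z}"

definition poisson_kernel :: "complex \<Rightarrow> complex \<Rightarrow> real" where
  "poisson_kernel z \<zeta> = (1 - (cmod z)\<^sup>2) / (cmod (\<zeta> - z))\<^sup>2"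

end

theory Submission
  imports Defs "HOL-Complex_Analysis.Complex_Analysis"
begin

text \<open>
  A holomorphic \<open>f\<close> is in the Nevanlinna class iff \<open>log_plus \<bar>f\<bar>\<close> has a positive harmonic majorant.
  Hence the trace is always contained in \<open>l_N\<close>, the space \<open>l_N\<close> is ideal, and if the trace is ideal,
  multiplying zero-free functions \<open>exp H\<close> by bounded sequences yields all of \<open>l_N\<close>.

  If the trace is \<open>l_N\<close>, split \<open>\<Lambda>\<close> into \<open>S\<close> and \<open>T\<close> so that every \<open>\<lambda>\<close> receives at least half of
  \<open>phi \<Lambda> \<lambda> = (\<Sum>\<mu>. - ln \<bar>b\<^sub>\<mu> \<lambda>\<bar>)\<close> from the part not containing it (Mills' lemma), and
  interpolate the indicator functions of \<open>S\<close> and \<open>T\<close>: by the Schwarz lemma, majorants of the two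
  interpolating functions bound \<open>phi \<Lambda>\<close>.  Conversely, if \<open>Re H\<close> dominates \<open>phi \<Lambda> + log_plus \<bar>a\<bar>\<close>
  on \<open>\<Lambda>\<close>, the functions \<open>\<Sum>\<lambda>\<in>F. a \<lambda> * B\<^sub>\<lambda> z / B\<^sub>\<lambda> \<lambda> * exp (H z - H \<lambda>) * ((1 - \<bar>\<lambda>\<bar>\<^sup>2) / (1 - cnj \<lambda> * z))\<^sup>2\<close>
  for finite \<open>F\<close> interpolate \<open>a\<close> on \<open>F\<close> with uniformly controlled majorants, and a normal family
  argument removes the finiteness.

  The majorant condition gives the dual inequality by the Poisson formula.  For the converse,
  minimise \<open>\<Sum>\<lambda>\<in>F. (max 0 (phi \<Lambda> \<lambda> - h \<lambda>))\<^sup>2\<close> over positive harmonic \<open>h\<close> with \<open>h 0 \<le> C\<close>; the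
  variational inequality at the minimiser contradicts the dual inequality unless the minimum is 0.
\<close>

section \<open>Harmonic functions as real parts\<close>

text \<open>The mean value theorem applies twice: in direction \<open>u\<close> to the increment of
  \<open>f\<close> along \<open>s *\<^sub>R v\<close>, then in direction \<open>v\<close> to
  \<open>f'\<close> evaluated at \<open>u\<close>. The second difference on the left is symmetric in
  \<open>u\<close> and \<open>v\<close>, which later forces symmetry of the second
  derivative.\<close>

lemma second_difference_mean_value:
  fixes f :: "complex \<Rightarrow> real" and f' :: "complex \<Rightarrow> complex \<Rightarrow>\<^sub>L real"
    and f'' :: "complex \<Rightarrow> complex \<Rightarrow>\<^sub>L complex \<Rightarrow>\<^sub>L real"
  assumes f': "\<And>w. w \<in> ball z r \<Longrightarrow> (f has_derivative f' w) (at w)"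
    and f'': "\<And>w. w \<in> ball z r \<Longrightarrow> (f' has_derivative f'' w) (at w)"
    and s: "0 < s" "s * (norm u + norm v) < r"
  obtains w where "dist z w \<le> s * (norm u + norm v)"
    "f (z + s *\<^sub>R u + s *\<^sub>R v) - f (z + s *\<^sub>R u) - f (z + s *\<^sub>R v) + f z = s\<^sup>2 * f'' w v u"
proof -
  have near: "dist z (z + x *\<^sub>R u + y *\<^sub>R v) \<le> s * (norm u + norm v)" if "0 \<le> x" "x \<le> s" "0 \<le> y" "y \<le> s" for x y
  proof -
    have "norm (x *\<^sub>R u + y *\<^sub>R v) \<le> x * norm u + y * norm v"
      using norm_triangle_ineq[of "x *\<^sub>R u" "y *\<^sub>R v"] that by simp
    also have "\<dots> \<le> s * norm u + s * norm v"
      using that by (intro add_mono mult_right_mono) auto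
    finally show ?thesis
      by (simp add: dist_norm norm_minus_commute algebra_simps)
  qed
  have inb: "z + x *\<^sub>R u + y *\<^sub>R v \<in> ball z r" if "0 \<le> x" "x \<le> s" "0 \<le> y" "y \<le> s" for x y
    using near[OF that] s by auto
  define \<phi> where "\<phi> x = f (z + x *\<^sub>R u + s *\<^sub>R v) - f (z + x *\<^sub>R u)" for x
  have d1: "(\<phi> has_real_derivative f' (z + x *\<^sub>R u + s *\<^sub>R v) u - f' (z + x *\<^sub>R u) u) (at x)"
    if "0 \<le> x" "x \<le> s" for x
  proof -
    have "((\<lambda>x. z + x *\<^sub>R u + s *\<^sub>R v) has_derivative (\<lambda>h. h *\<^sub>R u)) (at x)"
      "((\<lambda>x. z + x *\<^sub>R u) has_derivative (\<lambda>h. h *\<^sub>R u)) (at x)"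
      by (auto intro!: derivative_eq_intros)
    note 12 = has_derivative_compose[OF this(1) f'] has_derivative_compose[OF this(2) f']
    have 1: "((\<lambda>x. f (z + x *\<^sub>R u + s *\<^sub>R v)) has_derivative (\<lambda>h. f' (z + x *\<^sub>R u + s *\<^sub>R v) (h *\<^sub>R u))) (at x)"
      by (rule 12(1)) (use that s inb[of x s] in auto)
    have 2: "((\<lambda>x. f (z + x *\<^sub>R u)) has_derivative (\<lambda>h. f' (z + x *\<^sub>R u) (h *\<^sub>R u))) (at x)"
      by (rule 12(2)) (use that s inb[of x 0] in auto)
    show ?thesis
      unfolding \<phi>_def has_field_derivative_def
      by (rule has_derivative_eq_rhs[OF has_derivative_diff[OF 1 2]])
         (auto simp: blinfun.scaleR_right algebra_simps)
  qed
  obtain \<xi> where \<xi>: "0 < \<xi>" "\<xi> < s"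
    "\<phi> s - \<phi> 0 = s * (f' (z + \<xi> *\<^sub>R u + s *\<^sub>R v) u - f' (z + \<xi> *\<^sub>R u) u)"
    using MVT2[of 0 s \<phi> "\<lambda>x. f' (z + x *\<^sub>R u + s *\<^sub>R v) u - f' (z + x *\<^sub>R u) u"] d1 s by auto
  have d2: "((\<lambda>y. f' (z + \<xi> *\<^sub>R u + y *\<^sub>R v) u) has_real_derivative f'' (z + \<xi> *\<^sub>R u + y *\<^sub>R v) v u) (at y)"
    if "0 \<le> y" "y \<le> s" for y
  proof -
    have "((\<lambda>y. z + \<xi> *\<^sub>R u + y *\<^sub>R v) has_derivative (\<lambda>h. h *\<^sub>R v)) (at y)"
      by (auto intro!: derivative_eq_intros)
    note has_derivative_compose[OF this f'']
    then have "((\<lambda>y. f' (z + \<xi> *\<^sub>R u + y *\<^sub>R v)) has_derivative (\<lambda>h. f'' (z + \<xi> *\<^sub>R u + y *\<^sub>R v) (h *\<^sub>R v))) (at y)"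
      using that \<xi> inb[of \<xi> y] by auto
    note bounded_linear.has_derivative[OF blinfun.bounded_linear_left[of u] this]
    then show ?thesis
      unfolding has_field_derivative_def
      by (rule has_derivative_eq_rhs) (auto simp: blinfun.scaleR_right blinfun.scaleR_left algebra_simps)
  qed
  obtain \<eta> where \<eta>: "0 < \<eta>" "\<eta> < s"
    "f' (z + \<xi> *\<^sub>R u + s *\<^sub>R v) u - f' (z + \<xi> *\<^sub>R u) u = s * f'' (z + \<xi> *\<^sub>R u + \<eta> *\<^sub>R v) v u"
    using MVT2[of 0 s "\<lambda>y. f' (z + \<xi> *\<^sub>R u + y *\<^sub>R v) u" "\<lambda>y. f'' (z + \<xi> *\<^sub>R u + y *\<^sub>R v) v u"] d2 s by auto
  show thesis
  proof
    show "dist z (z + \<xi> *\<^sub>R u + \<eta> *\<^sub>R v) \<le> s * (norm u + norm v)"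
      using near \<xi> \<eta> by simp
    show "f (z + s *\<^sub>R u + s *\<^sub>R v) - f (z + s *\<^sub>R u) - f (z + s *\<^sub>R v) + f z
        = s\<^sup>2 * f'' (z + \<xi> *\<^sub>R u + \<eta> *\<^sub>R v) v u"
      using \<xi>(3) \<eta>(3) by (simp add: \<phi>_def power2_eq_square)
  qed
qed

text \<open>Computing one second difference in both orders gives
  \<open>f'' w v u = f'' w' u v\<close> at two points close to \<open>z\<close>. Shrinking the step
  and using continuity of \<open>f''\<close> moves both points to \<open>z\<close>.\<close>

lemma second_derivative_symmetric:
  fixes f :: "complex \<Rightarrow> real" and f' :: "complex \<Rightarrow> complex \<Rightarrow>\<^sub>L real"
    and f'' :: "complex \<Rightarrow> complex \<Rightarrow>\<^sub>L complex \<Rightarrow>\<^sub>L real"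
  assumes "open S" "z \<in> S"
    and f': "\<And>w. w \<in> S \<Longrightarrow> (f has_derivative f' w) (at w)"
    and f'': "\<And>w. w \<in> S \<Longrightarrow> (f' has_derivative f'' w) (at w)"
    and cont: "continuous_on S f''"
  shows "f'' z u v = f'' z v u"
proof -
  obtain r where r: "r > 0" "ball z r \<subseteq> S"
    using assms(1,2) openE by blast
  define M where "M = norm u + norm v"
  have "M \<ge> 0" by (simp add: M_def)
  \<comment> \<open>The factor keeps \<open>s n * M\<close> below \<open>r / 2\<close>, so all the
    points used stay in the ball; \<open>M + 1\<close> keeps the denominator positive when
    \<open>u\<close> and \<open>v\<close> vanish.\<close>
  define s where "s n = r / (2 * (M + 1)) * inverse (real (Suc n))" for n
  have s: "0 < s n" "s n * M < r" for n
  proof -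
    show "0 < s n" using r \<open>M \<ge> 0\<close> by (simp add: s_def)
    have "s n \<le> r / (2 * (M + 1))"
      using r \<open>M \<ge> 0\<close> unfolding s_def
      by (intro mult_left_le) (auto simp: field_simps)
    then have "s n * M \<le> r / (2 * (M + 1)) * M"
      using \<open>M \<ge> 0\<close> mult_right_mono by blast
    also have "\<dots> < r" using r \<open>M \<ge> 0\<close> by (simp add: field_simps add_nonneg_pos)
    finally show "s n * M < r" .
  qed
  have fb: "(f has_derivative f' w) (at w)" and f''b: "(f' has_derivative f'' w) (at w)"
    if "w \<in> ball z r" for w
    using f' f'' r(2) that by auto
  have s0: "s \<longlonglongrightarrow> 0"
    unfolding s_def by (intro tendsto_mult_right_zero LIMSEQ_inverse_real_of_nat)
  have "\<exists>w w'. dist z w \<le> s n * M \<and> dist z w' \<le> s n * M \<and> f'' w v u = f'' w' u v" for n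
  proof -
    obtain w where w: "dist z w \<le> s n * (norm u + norm v)"
      "f (z + s n *\<^sub>R u + s n *\<^sub>R v) - f (z + s n *\<^sub>R u) - f (z + s n *\<^sub>R v) + f z = (s n)\<^sup>2 * f'' w v u"
      using second_difference_mean_value[OF fb f''b s(1) s(2)[unfolded M_def]] by metis
    obtain w' where w': "dist z w' \<le> s n * (norm v + norm u)"
      "f (z + s n *\<^sub>R v + s n *\<^sub>R u) - f (z + s n *\<^sub>R v) - f (z + s n *\<^sub>R u) + f z = (s n)\<^sup>2 * f'' w' u v"
      using second_difference_mean_value[OF fb f''b s(1) s(2)[unfolded M_def add.commute[of "norm u"]]] by metis
    have "(s n)\<^sup>2 * f'' w v u = (s n)\<^sup>2 * f'' w' u v"
      using w(2) w'(2) by (simp add: algebra_simps)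
    then have "f'' w v u = f'' w' u v" using s[of n] by simp
    with w w' show ?thesis unfolding M_def by (auto simp: add.commute)
  qed
  then obtain w w' where w: "\<And>n. dist z (w n) \<le> s n * M" "\<And>n. dist z (w' n) \<le> s n * M"
    and eq: "\<And>n. f'' (w n) v u = f'' (w' n) u v"
    by metis
  have sM: "(\<lambda>n. s n * M) \<longlonglongrightarrow> 0" using tendsto_mult_left_zero[OF s0] by simp
  have lim: "(\<lambda>n. f'' (x n)) \<longlonglongrightarrow> f'' z" if "\<And>n. dist z (x n) \<le> s n * M" for x
  proof -
    have "x \<longlonglongrightarrow> z"
      by (rule metric_tendsto_imp_tendsto[OF sM])
         (use that s \<open>M \<ge> 0\<close> in \<open>auto intro!: always_eventually simp: dist_commute abs_mult abs_of_pos[OF s(1)]\<close>)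
    moreover have "x n \<in> S" for n
      using that[of n] s[of n] r by (auto simp: subset_iff)
    ultimately show ?thesis
      using cont \<open>z \<in> S\<close> unfolding continuous_on_sequentially o_def by blast
  qed
  have "(\<lambda>n. f'' (w n) v u) \<longlonglongrightarrow> f'' z v u"
    by (intro blinfun.tendsto lim w tendsto_const)
  moreover have "(\<lambda>n. f'' (w' n) u v) \<longlonglongrightarrow> f'' z u v"
    by (intro blinfun.tendsto lim w tendsto_const)
  ultimately show ?thesis
    using eq LIMSEQ_unique by auto
qed

text \<open>The function \<open>g\<close>, with real part the derivative of \<open>h\<close> along 1
  and imaginary part minus that along \<open>\<i>\<close>, satisfies the Cauchy-Riemann equations:
  one is the Laplace equation, the other is the symmetry of the second derivative. On a convex set
  \<open>g\<close> has a primitive, whose real part differs from \<open>h\<close> by a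
  constant.\<close>

lemma harmonic_on_imp_Re_holomorphic:
  assumes "open S" "convex S" "harmonic_on h S"
  obtains H where "H holomorphic_on S" "\<And>z. z \<in> S \<Longrightarrow> h z = Re (H z)"
proof (cases "S = {}")
  case True
  then show thesis using that[of "\<lambda>_. 0"] by auto
next
  case False
  then obtain z0 where z0: "z0 \<in> S" by auto
  obtain h' and h'' :: "complex \<Rightarrow> complex \<Rightarrow>\<^sub>L complex \<Rightarrow>\<^sub>L real"
    where h': "\<And>z. z \<in> S \<Longrightarrow> (h has_derivative blinfun_apply (h' z)) (at z)"
    and h'': "\<And>z. z \<in> S \<Longrightarrow> (h' has_derivative blinfun_apply (h'' z)) (at z)"
    and cont: "continuous_on S h''"
    and lap: "\<And>z. z \<in> S \<Longrightarrow> h'' z 1 1 + h'' z \<i> \<i> = 0"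
    using assms(3) unfolding harmonic_on_def by blast
  have decomp: "v = Re v *\<^sub>R 1 + Im v *\<^sub>R \<i>" for v
    by (simp add: complex_eq_iff)
  define g where "g z = Complex (h' z 1) (- h' z \<i>)" for z
  have dg: "(g has_field_derivative Complex (h'' z 1 1) (- h'' z 1 \<i>)) (at z)" if z: "z \<in> S" for z
  proof -
    have *: "((\<lambda>z. h' z u) has_derivative (\<lambda>v. h'' z v u)) (at z)" for u
      by (rule bounded_linear.has_derivative[OF blinfun.bounded_linear_left h''[OF z]])
    have g_eq: "g = (\<lambda>z. of_real (h' z 1) - \<i> * of_real (h' z \<i>))"
      by (auto simp: g_def complex_eq_iff)
    have "(g has_derivative (\<lambda>v. of_real (h'' z v 1) - \<i> * of_real (h'' z v \<i>))) (at z)"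
      unfolding g_eq by (intro derivative_intros *)
    moreover have "(\<lambda>v. of_real (h'' z v 1) - \<i> * of_real (h'' z v \<i>))
        = (*) (Complex (h'' z 1 1) (- h'' z 1 \<i>))"
    proof
      fix v
      have e: "h'' z v u = Re v * h'' z 1 u + Im v * h'' z \<i> u" for u
        by (subst decomp[of v]) (simp add: blinfun.add_right blinfun.add_left blinfun.scaleR_right blinfun.scaleR_left del: scaleR_one)
      have lap2: "h'' z \<i> \<i> = - h'' z 1 1"
        using lap[OF z] by linarith
      have sym: "h'' z \<i> 1 = h'' z 1 \<i>"
        by (rule second_derivative_symmetric[OF assms(1) z h' h'' cont])
      show "of_real (h'' z v 1) - \<i> * of_real (h'' z v \<i>) = Complex (h'' z 1 1) (- h'' z 1 \<i>) * v"
        using lap2 by (simp add: complex_eq_iff e sym)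
    qed
    ultimately show ?thesis
      by (simp add: has_field_derivative_def)
  qed
  then have "g holomorphic_on S"
    using assms(1) holomorphic_on_open by blast
  then obtain G where G: "\<And>z. z \<in> S \<Longrightarrow> (G has_field_derivative g z) (at z)"
    using holomorphic_convex_primitive'[OF assms(2,1)] assms(1) by (metis at_within_open)
  have "((\<lambda>z. Re (G z) - h z) has_derivative (\<lambda>v. 0)) (at z within S)" if z: "z \<in> S" for z
  proof -
    have "((\<lambda>z. Re (G z) - h z) has_derivative (\<lambda>v. Re (g z * v) - h' z v)) (at z)"
      by (intro derivative_intros h' z G[OF z, unfolded has_field_derivative_def])
    moreover have "(\<lambda>v. Re (g z * v) - h' z v) = (\<lambda>v. 0)"
    proof
      fix v
      have "h' z v = Re v * h' z 1 + Im v * h' z \<i>"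
        by (subst decomp[of v]) (simp add: blinfun.add_right blinfun.scaleR_right del: scaleR_one)
      then show "Re (g z * v) - h' z v = 0" by (simp add: g_def)
    qed
    ultimately show ?thesis using has_derivative_at_withinI by metis
  qed
  then obtain c where c: "\<And>z. z \<in> S \<Longrightarrow> Re (G z) - h z = c"
    using has_derivative_zero_constant[OF assms(2), of "\<lambda>z. Re (G z) - h z"] by metis
  show thesis
  proof
    show "(\<lambda>z. G z - of_real c) holomorphic_on S"
      using G assms(1) holomorphic_on_open by (intro holomorphic_intros) blast
    show "h z = Re (G z - of_real c)" if "z \<in> S" for z using c[OF that] by simp
  qed
qed

text \<open>The second derivative of \<open>Re H\<close> sends \<open>(v, u)\<close> to the real
  part of \<open>deriv (deriv H) z * v * u\<close>; the contributions of 1 and \<open>\<i>\<close>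
  cancel because \<open>\<i> * \<i> = - 1\<close>.\<close>

lemma Re_holomorphic_imp_harmonic_on:
  assumes "open S" "H holomorphic_on S" "\<And>z. z \<in> S \<Longrightarrow> h z = Re (H z)"
  shows "harmonic_on h S"
proof -
  \<comment> \<open>\<open>R a\<close> is multiplication by \<open>a\<close> followed by the real
    part, written as an inner product so that it depends on \<open>a\<close> in a bounded linear
    way.\<close>
  define R :: "complex \<Rightarrow> complex \<Rightarrow>\<^sub>L real" where "R a = blinfun_inner_right (cnj a)" for a
  have R_apply [simp]: "R a v = Re (a * v)" for a v
    by (simp add: R_def inner_complex_def)
  have bl_R: "bounded_linear R"
    unfolding R_def by (rule bounded_linear_compose[OF bounded_linear_blinfun_inner_right bounded_linear_cnj])
  define T :: "complex \<Rightarrow> complex \<Rightarrow>\<^sub>L complex \<Rightarrow>\<^sub>L real" where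
    "T a = Blinfun R o\<^sub>L blinfun_mult_right a" for a
  have T_apply [simp]: "T a v = R (a * v)" for a v
    by (simp add: T_def bounded_linear_Blinfun_apply[OF bl_R])
  have hol': "deriv H holomorphic_on S" and hol'': "deriv (deriv H) holomorphic_on S"
    using assms(1,2) by (auto intro!: holomorphic_deriv)
  have d: "(H has_derivative (*) (deriv H z)) (at z)" "(deriv H has_derivative (*) (deriv (deriv H) z)) (at z)"
    if "z \<in> S" for z
    using holomorphic_derivI[OF assms(2,1) that] holomorphic_derivI[OF hol' assms(1) that]
    by (auto simp: has_field_derivative_def)
  show ?thesis
    unfolding harmonic_on_def
  proof (intro exI conjI ballI)
    fix z assume z: "z \<in> S"
    have "((\<lambda>z. Re (H z)) has_derivative R (deriv H z)) (at z)"
      by (rule has_derivative_eq_rhs[OF bounded_linear.has_derivative[OF bounded_linear_Re d(1)[OF z]]]) auto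
    then show "(h has_derivative R (deriv H z)) (at z)"
      by (rule has_derivative_transform_within_open[OF _ assms(1) z]) (simp add: assms(3))
    show "((\<lambda>z. R (deriv H z)) has_derivative T (deriv (deriv H) z)) (at z)"
      by (rule has_derivative_eq_rhs[OF bounded_linear.has_derivative[OF bl_R d(2)[OF z]]]) auto
    show "T (deriv (deriv H) z) 1 1 + T (deriv (deriv H) z) \<i> \<i> = 0"
      by simp
  next
    show "continuous_on S (\<lambda>z. T (deriv (deriv H) z))"
      unfolding T_def
      by (intro continuous_intros bounded_linear.continuous_on[OF bounded_linear_blinfun_mult_right]
            bounded_bilinear.continuous_on[OF bounded_bilinear_blinfun_compose] holomorphic_on_imp_continuous_on hol'')
  qed
qed

section \<open>Normal families of positive harmonic functions\<close>

lemma positive_harmonicI: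
  assumes "H holomorphic_on unit_disc" "\<And>z. z \<in> unit_disc \<Longrightarrow> h z = Re (H z)"
    "\<And>z. z \<in> unit_disc \<Longrightarrow> 0 \<le> h z"
  shows "h \<in> positive_harmonic"
  using Re_holomorphic_imp_harmonic_on[OF open_ball assms(1,2)] assms(3)
  by (auto simp: positive_harmonic_def)

text \<open>The working form of positive harmonicity: sums, multiples and limits are handled through
  holomorphic functions, and \<open>exp (- H)\<close> becomes available as a zero-free function
  bounded by 1.\<close>

lemma positive_harmonic_iff:
  "h \<in> positive_harmonic \<longleftrightarrow>
    (\<exists>H. H holomorphic_on unit_disc \<and> (\<forall>z\<in>unit_disc. h z = Re (H z)) \<and> (\<forall>z\<in>unit_disc. 0 \<le> h z))"
proof
  assume "h \<in> positive_harmonic"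
  then have h: "harmonic_on h unit_disc" "\<forall>z\<in>unit_disc. 0 \<le> h z"
    by (simp_all add: positive_harmonic_def)
  show "\<exists>H. H holomorphic_on unit_disc \<and> (\<forall>z\<in>unit_disc. h z = Re (H z)) \<and> (\<forall>z\<in>unit_disc. 0 \<le> h z)"
    by (rule harmonic_on_imp_Re_holomorphic[OF open_ball convex_ball h(1)]) (use h(2) in blast)
qed (use positive_harmonicI in blast)

lemma positive_harmonic_nonneg: "h \<in> positive_harmonic \<Longrightarrow> z \<in> unit_disc \<Longrightarrow> 0 \<le> h z"
  by (simp add: positive_harmonic_def)

lemma positive_harmonic_add:
  assumes "h \<in> positive_harmonic" "k \<in> positive_harmonic"
  shows "(\<lambda>z. h z + k z) \<in> positive_harmonic"
proof -
  obtain H K where HK: "H holomorphic_on unit_disc" "\<And>z. z \<in> unit_disc \<Longrightarrow> h z = Re (H z)"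
    "\<And>z. z \<in> unit_disc \<Longrightarrow> 0 \<le> h z" "K holomorphic_on unit_disc"
    "\<And>z. z \<in> unit_disc \<Longrightarrow> k z = Re (K z)" "\<And>z. z \<in> unit_disc \<Longrightarrow> 0 \<le> k z"
    using assms unfolding positive_harmonic_iff by blast
  show ?thesis
    by (rule positive_harmonicI[of "\<lambda>z. H z + K z"]) (use HK in \<open>auto intro!: holomorphic_intros\<close>)
qed

lemma positive_harmonic_scale:
  assumes "h \<in> positive_harmonic" "c \<ge> 0"
  shows "(\<lambda>z. c * h z) \<in> positive_harmonic"
proof -
  obtain H where H: "H holomorphic_on unit_disc" "\<And>z. z \<in> unit_disc \<Longrightarrow> h z = Re (H z)"
    "\<And>z. z \<in> unit_disc \<Longrightarrow> 0 \<le> h z"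
    using assms unfolding positive_harmonic_iff by blast
  show ?thesis
    by (rule positive_harmonicI[of "\<lambda>z. of_real c * H z"]) (use H assms in \<open>auto intro!: holomorphic_intros\<close>)
qed

lemma positive_harmonic_const: "c \<ge> 0 \<Longrightarrow> (\<lambda>z. c) \<in> positive_harmonic"
  by (rule positive_harmonicI[of "\<lambda>z. of_real c"]) auto

lemma positive_harmonic_sum:
  assumes "finite F" "\<And>i. i \<in> F \<Longrightarrow> h i \<in> positive_harmonic"
  shows "(\<lambda>z. \<Sum>i\<in>F. h i z) \<in> positive_harmonic"
  using assms
  by (induction F) (auto intro: positive_harmonic_const positive_harmonic_add)

lemma log_plus_le_iff: "x \<ge> 0 \<Longrightarrow> log_plus x \<le> y \<longleftrightarrow> 0 \<le> y \<and> x \<le> exp y"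
  by (cases "x = 0") (use ln_ge_iff[of x] ln_le_cancel_iff[of x "exp y"] in \<open>auto simp: log_plus_def\<close>)

text \<open>Montel's theorem for the unit ball. Locally uniform convergence is kept besides the
  pointwise one because Hurwitz's theorem asks for it.\<close>

lemma unit_bounded_normal:
  fixes f :: "nat \<Rightarrow> complex \<Rightarrow> complex"
  assumes "\<And>n. f n holomorphic_on unit_disc" "\<And>n z. z \<in> unit_disc \<Longrightarrow> cmod (f n z) \<le> 1"
  shows "\<exists>g r. g holomorphic_on unit_disc \<and> strict_mono (r :: nat \<Rightarrow> nat) \<and>
    (\<forall>z\<in>unit_disc. (\<lambda>n. f (r n) z) \<longlonglongrightarrow> g z) \<and>
    (\<forall>K. compact K \<and> K \<subseteq> unit_disc \<longrightarrow> uniform_limit K (f \<circ> r) g sequentially)"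
proof -
  let ?H = "{f. f holomorphic_on unit_disc \<and> (\<forall>z\<in>unit_disc. cmod (f z) \<le> 1)}"
  show ?thesis
  proof (rule Montel[of unit_disc ?H f])
    show "\<exists>B. \<forall>h\<in>?H. \<forall>z\<in>K. cmod (h z) \<le> B" if "K \<subseteq> unit_disc" for K
      using that by (intro exI[of _ 1]) auto
    show "?thesis" if "g holomorphic_on unit_disc" "strict_mono (r :: nat \<Rightarrow> nat)"
      "\<And>z. z \<in> unit_disc \<Longrightarrow> (\<lambda>n. f (r n) z) \<longlonglongrightarrow> g z"
      "\<And>K. compact K \<Longrightarrow> K \<subseteq> unit_disc \<Longrightarrow> uniform_limit K (f \<circ> r) g sequentially" for g r
      using that by (intro exI[of _ g] exI[of _ r] conjI ballI allI impI) auto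
  qed (use assms in auto)
qed

text \<open>With \<open>h n = Re (H n)\<close>, both \<open>exp (- H n)\<close> and \<open>f n * exp (- H n)\<close> are bounded by 1, so Montel applies; the bound at 0 and Hurwitz keep the limit of \<open>exp (- H n)\<close> free of zeros.\<close>

lemma harmonic_majorants_normal:
  fixes f :: "nat \<Rightarrow> complex \<Rightarrow> complex"
  assumes f: "\<And>n. f n holomorphic_on unit_disc"
    and h: "\<And>n. h n \<in> positive_harmonic"
    and fh: "\<And>n z. z \<in> unit_disc \<Longrightarrow> cmod (f n z) \<le> exp (h n z)"
    and M: "\<And>n. h n 0 \<le> M"
  shows "\<exists>r g k. strict_mono (r :: nat \<Rightarrow> nat) \<and> g holomorphic_on unit_disc \<and> k \<in> positive_harmonic \<and>
    (\<forall>z\<in>unit_disc. (\<lambda>n. f (r n) z) \<longlonglongrightarrow> g z) \<and> (\<forall>z\<in>unit_disc. (\<lambda>n. h (r n) z) \<longlonglongrightarrow> k z)"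
proof -
  have "\<exists>H. H holomorphic_on unit_disc \<and> (\<forall>z\<in>unit_disc. h n z = Re (H z))" for n
    using h[of n] unfolding positive_harmonic_iff by blast
  then obtain H where H: "\<And>n. H n holomorphic_on unit_disc"
    and hH: "\<And>n z. z \<in> unit_disc \<Longrightarrow> h n z = Re (H n z)"
    by metis
  define G where "G n z = exp (- H n z)" for n z
  have G: "G n holomorphic_on unit_disc" for n
    unfolding G_def by (intro holomorphic_intros H)
  have cG: "cmod (G n z) = exp (- h n z)" if "z \<in> unit_disc" for n z
    using hH[OF that] by (simp add: G_def)
  have G1: "cmod (G n z) \<le> 1" if "z \<in> unit_disc" for n z
    using cG[OF that] positive_harmonic_nonneg[OF h that] by simp
  obtain g1 r1 where g1: "g1 holomorphic_on unit_disc" and r1: "strict_mono (r1 :: nat \<Rightarrow> nat)"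
    and lim1: "\<And>z. z \<in> unit_disc \<Longrightarrow> (\<lambda>n. G (r1 n) z) \<longlonglongrightarrow> g1 z"
    and unif: "\<And>K. compact K \<Longrightarrow> K \<subseteq> unit_disc \<Longrightarrow> uniform_limit K (G \<circ> r1) g1 sequentially"
    using unit_bounded_normal[of G, OF G G1] by blast
  have "cmod (f (r1 n) z * G (r1 n) z) \<le> 1" if "z \<in> unit_disc" for n z
    using fh[OF that, of "r1 n"] by (simp add: norm_mult cG[OF that] exp_minus divide_simps)
  moreover have "(\<lambda>z. f (r1 n) z * G (r1 n) z) holomorphic_on unit_disc" for n
    by (intro holomorphic_intros f G)
  ultimately have "\<exists>g r. g holomorphic_on unit_disc \<and> strict_mono (r :: nat \<Rightarrow> nat) \<and>
      (\<forall>z\<in>unit_disc. (\<lambda>n. f (r1 (r n)) z * G (r1 (r n)) z) \<longlonglongrightarrow> g z)"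
    using unit_bounded_normal[of "\<lambda>n z. f (r1 n) z * G (r1 n) z"] by fast
  then obtain g2 and r2 :: "nat \<Rightarrow> nat" where g2: "g2 holomorphic_on unit_disc" and r2: "strict_mono r2"
    and lim2: "\<And>z. z \<in> unit_disc \<Longrightarrow> (\<lambda>n. f (r1 (r2 n)) z * G (r1 (r2 n)) z) \<longlonglongrightarrow> g2 z"
    by blast
  have lim1': "(\<lambda>n. G (r1 (r2 n)) z) \<longlonglongrightarrow> g1 z" if "z \<in> unit_disc" for z
    using LIMSEQ_subseq_LIMSEQ[OF lim1[OF that] r2] by (simp add: o_def)
  have "exp (- M) \<le> cmod (g1 0)"
  proof (rule LIMSEQ_le_const)
    show "(\<lambda>n. cmod (G (r1 n) 0)) \<longlonglongrightarrow> cmod (g1 0)"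
      by (intro tendsto_norm lim1) simp
    show "\<exists>N. \<forall>n\<ge>N. exp (- M) \<le> cmod (G (r1 n) 0)"
      using M by (auto simp: cG)
  qed
  then have g10: "g1 0 \<noteq> 0"
    by (metis exp_gt_zero norm_zero not_le)
  have g1nz: "g1 z \<noteq> 0" if z: "z \<in> unit_disc" for z
  proof (cases "g1 constant_on unit_disc")
    case True
    then have "g1 z = g1 0" using z unfolding constant_on_def by (metis centre_in_ball zero_less_one)
    then show ?thesis using g10 by simp
  next
    case False
    show ?thesis
      by (rule Hurwitz_no_zeros[OF open_ball connected_ball _ g1 unif False _ z])
         (use G in \<open>auto simp: G_def\<close>)
  qed
  have "\<exists>L. L holomorphic_on unit_disc \<and> (\<forall>z\<in>unit_disc. g1 z = exp (L z))"
    by (rule contractible_imp_holomorphic_log[OF g1 convex_imp_contractible[OF convex_ball] g1nz]) blast+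
  then obtain L where L: "L holomorphic_on unit_disc" "\<And>z. z \<in> unit_disc \<Longrightarrow> g1 z = exp (L z)"
    by blast
  \<comment> \<open>Since \<open>h\<close> is minus the logarithm of \<open>cmod G\<close>, the
    zero-free limit \<open>g1 = exp L\<close> gives the limit of \<open>h\<close> as minus the real
    part of \<open>L\<close>.\<close>
  have limh: "(\<lambda>n. h (r1 (r2 n)) z) \<longlonglongrightarrow> - Re (L z)" if z: "z \<in> unit_disc" for z
  proof -
    have "(\<lambda>n. ln (cmod (G (r1 (r2 n)) z))) \<longlonglongrightarrow> ln (cmod (g1 z))"
      by (intro tendsto_ln tendsto_norm lim1'[OF z]) (simp add: g1nz[OF z])
    then show ?thesis
      by (simp add: cG[OF z] L(2)[OF z] tendsto_minus_cancel_left)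
  qed
  have "strict_mono (r1 \<circ> r2)" using r1 r2 by (rule strict_mono_o)
  moreover have "(\<lambda>z. g2 z / g1 z) holomorphic_on unit_disc"
    by (intro holomorphic_intros g1 g2) (use g1nz in auto)
  moreover have "(\<lambda>n. f ((r1 \<circ> r2) n) z) \<longlonglongrightarrow> g2 z / g1 z" if z: "z \<in> unit_disc" for z
    using tendsto_divide[OF lim2[OF z] lim1'[OF z] g1nz[OF z]] by (simp add: G_def)
  moreover have "(\<lambda>n. h ((r1 \<circ> r2) n) z) \<longlonglongrightarrow> Re (- L z)" if z: "z \<in> unit_disc" for z
    using limh[OF z] by simp
  moreover have "(\<lambda>z. Re (- L z)) \<in> positive_harmonic"
  proof (rule positive_harmonicI)
    show "(\<lambda>z. - L z) holomorphic_on unit_disc" by (intro holomorphic_intros L)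
    show "0 \<le> Re (- L z)" if z: "z \<in> unit_disc" for z
      using LIMSEQ_le_const[OF limh[OF z], of 0] positive_harmonic_nonneg[OF h z] by auto
  qed auto
  ultimately show ?thesis
    by (intro exI[of _ "r1 \<circ> r2"] exI[of _ "\<lambda>z. g2 z / g1 z"] exI[of _ "\<lambda>z. Re (- L z)"]) blast
qed

section \<open>Harmonic majorants and the Nevanlinna class\<close>

text \<open>This form exhibits \<open>log_plus\<close> as continuous at 0, since the argument of the
  logarithm stays at least 1.\<close>

lemma log_plus_eq_ln_max: "x \<ge> 0 \<Longrightarrow> log_plus x = ln (max 1 x)"
  by (cases "x = 0") (auto simp: log_plus_def max_def)

lemma log_plus_nonneg: "0 \<le> log_plus x"
  by (simp add: log_plus_def)

lemma continuous_on_log_plus_cmod: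
  assumes "continuous_on S f"
  shows "continuous_on S (\<lambda>x. log_plus (cmod (f x)))"
  unfolding log_plus_eq_ln_max[OF norm_ge_zero]
  by (intro continuous_intros assms) auto

section \<open>The Poisson formula\<close>

text \<open>On the circle conjugation is inversion, so the kernel splits into a Cauchy kernel at
  \<open>w\<close> and a function of \<open>u\<close> that is holomorphic on the closed disc and
  vanishes at 0.\<close>

lemma poisson_kernel_circle:
  assumes "cmod u = 1" "cmod w < 1"
  shows "of_real (poisson_kernel w u) = u / (u - w) + cnj w * u / (1 - cnj w * u)"
proof -
  have uu: "u * cnj u = 1" using assms(1) by (simp add: complex_norm_square[symmetric])
  have "u \<noteq> 0" "u \<noteq> w" using assms by auto
  have eq: "1 - cnj w * u = u * cnj (u - w)" using uu by (simp add: algebra_simps)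
  have "of_real (poisson_kernel w u) = (1 - w * cnj w) / ((u - w) * cnj (u - w))"
    unfolding poisson_kernel_def of_real_divide of_real_diff complex_norm_square by simp
  also have "1 - w * cnj w = u * cnj (u - w) + cnj w * (u - w)"
    using uu by (simp add: algebra_simps)
  also have "(u * cnj (u - w) + cnj w * (u - w)) / ((u - w) * cnj (u - w)) = u / (u - w) + cnj w / cnj (u - w)"
    using \<open>u \<noteq> w\<close> by (simp add: add_divide_distrib)
  also have "cnj w / cnj (u - w) = cnj w * u / (1 - cnj w * u)"
    unfolding eq using \<open>u \<noteq> 0\<close> by simp
  finally show ?thesis .
qed

text \<open>Cauchy's formula evaluates both terms of \<open>poisson_kernel_circle\<close>: the first
  gives \<open>H w\<close>, the second the value at 0 of a function vanishing there.\<close>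

lemma Re_poisson_integral:
  assumes H: "H holomorphic_on cball 0 1" and w: "cmod w < 1"
  shows "((\<lambda>t. poisson_kernel w (cis t) * Re (H (cis t))) has_integral 2 * pi * Re (H w)) {0..2 * pi}"
proof -
  have nz: "1 - cnj w * u \<noteq> 0" if "cmod u \<le> 1" for u
  proof
    assume "1 - cnj w * u = 0"
    then have "cmod w * cmod u = 1"
      by (metis complex_mod_cnj eq_iff_diff_eq_0 norm_mult norm_one)
    moreover have "cmod w * cmod u \<le> cmod w" using that by (simp add: mult_left_le)
    ultimately show False using w by simp
  qed
  have "((\<lambda>u. H u / (u - w)) has_contour_integral 2 * of_real pi * \<i> * H w) (circlepath 0 1)"
    by (rule Cauchy_integral_circlepath_simple) (use assms in auto)
  moreover
  have "((\<lambda>u. (H u * (cnj w * u / (1 - cnj w * u))) / (u - 0)) has_contour_integral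
      2 * of_real pi * \<i> * (H 0 * (cnj w * 0 / (1 - cnj w * 0)))) (circlepath 0 1)"
    by (rule Cauchy_integral_circlepath_simple) (use H nz in \<open>auto intro!: holomorphic_intros\<close>)
  ultimately
  have "((\<lambda>u. H u / (u - w) + (H u * (cnj w * u / (1 - cnj w * u))) / (u - 0)) has_contour_integral
      2 * of_real pi * \<i> * H w + 2 * of_real pi * \<i> * (H 0 * (cnj w * 0 / (1 - cnj w * 0)))) (circlepath 0 1)"
    by (rule has_contour_integral_add)
  then have "((\<lambda>t. (H (cis t) / (cis t - w) + (H (cis t) * (cnj w * cis t / (1 - cnj w * cis t))) / cis t) * \<i> * cis t)
      has_integral 2 * of_real pi * \<i> * H w) {0..2 * pi}"
    unfolding circlepath_def by (subst (asm) has_contour_integral_part_circlepath_iff) auto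
  moreover have "(H (cis t) / (cis t - w) + (H (cis t) * (cnj w * cis t / (1 - cnj w * cis t))) / cis t) * \<i> * cis t
      = \<i> * (of_real (poisson_kernel w (cis t)) * H (cis t))" for t
  proof -
    have "(a / (c - w) + a * x / c) * \<i> * c = \<i> * ((c / (c - w) + x) * a)" if "c \<noteq> 0" for a c x
      using that by (simp add: ring_distribs)
    from this[OF cis_neq_zero] show ?thesis
      unfolding poisson_kernel_circle[OF norm_cis w] .
  qed
  ultimately have "((\<lambda>t. \<i> * (of_real (poisson_kernel w (cis t)) * H (cis t))) has_integral 2 * of_real pi * \<i> * H w) {0..2 * pi}"
    by (simp only:)
  \<comment> \<open>The contour integral is \<open>\<i>\<close> times the Poisson integral of
    \<open>H\<close>, so its imaginary part is the Poisson integral of \<open>Re H\<close>.\<close>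
  from has_integral_linear[OF this bounded_linear_Im]
  show ?thesis by (simp add: o_def)
qed

lemma Re_mean_value:
  assumes "H holomorphic_on cball 0 1"
  shows "((\<lambda>t. Re (H (cis t))) has_integral 2 * pi * Re (H 0)) {0..2 * pi}"
  using Re_poisson_integral[OF assms, of 0] by (simp add: poisson_kernel_def)

section \<open>Trigonometric polynomials and approximation on the circle\<close>

text \<open>For monomials use \<open>Re x * Re y = Re (x * y / 2 + cnj x * y / 2)\<close>; on the
  circle the conjugate of \<open>z ^ j\<close> cancels \<open>j\<close> factors of
  \<open>z ^ k\<close>, so for \<open>j \<le> k\<close> both terms are again polynomials in
  \<open>z\<close>. Bilinearity does the rest.\<close>

lemma Re_poly_mult_circle:
  fixes p q :: "complex poly"
  shows "\<exists>r. \<forall>z\<in>sphere 0 1. Re (poly p z) * Re (poly q z) = Re (poly r z)"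
proof -
  define T where "T g \<longleftrightarrow> (\<exists>r::complex poly. \<forall>z\<in>sphere 0 1. g z = Re (poly r z))" for g
  have T_add: "T (\<lambda>z. g z + h z)" if "T g" "T h" for g h
    using that unfolding T_def by (metis poly_add plus_complex.sel(1))
  have T0: "T (\<lambda>z. 0)" unfolding T_def by (intro exI[of _ 0]) simp
  have T_sum: "T (\<lambda>z. \<Sum>i\<in>I. g i z)" if "finite I" "\<And>i. T (g i)" for I :: "nat set" and g
    using that(1) by induction (auto intro: T0 T_add that(2))
  have mono: "T (\<lambda>z. Re (a * z ^ j) * Re (b * z ^ k))" if "j \<le> k" for a b :: complex and j k :: nat
  proof -
    have "Re (a * z ^ j) * Re (b * z ^ k) = Re (poly (monom (a * b / 2) (j + k) + monom (cnj a * b / 2) (k - j)) z)"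
      if z: "z \<in> sphere 0 1" for z
    proof -
      have "cnj z * z = 1" using z by (simp add: complex_norm_square[symmetric] mult.commute)
      then have "cnj (z ^ j) * z ^ j = 1" by (metis complex_cnj_power power_mult_distrib power_one)
      moreover have "z ^ k = z ^ j * z ^ (k - j)" using \<open>j \<le> k\<close> by (simp add: power_add[symmetric])
      ultimately have "cnj (a * z ^ j) * (b * z ^ k) = cnj a * b * z ^ (k - j)"
        by (simp add: algebra_simps)
      moreover have "Re x * Re y = Re (x * y / 2 + cnj x * y / 2)" for x y
        by (simp add: add_divide_distrib[symmetric])
      ultimately have "Re (a * z ^ j) * Re (b * z ^ k) = Re ((a * z ^ j) * (b * z ^ k) / 2 + cnj a * b * z ^ (k - j) / 2)"
        by metis
      also have "\<dots> = Re (poly (monom (a * b / 2) (j + k) + monom (cnj a * b / 2) (k - j)) z)"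
        by (simp add: poly_monom power_add algebra_simps)
      finally show ?thesis .
    qed
    then show ?thesis unfolding T_def by blast
  qed
  have mono': "T (\<lambda>z. Re (a * z ^ j) * Re (b * z ^ k))" for a b :: complex and j k :: nat
    using mono[of j k a b] mono[of k j b a] by (cases "j \<le> k") (auto simp: mult.commute)
  have "T (\<lambda>z. \<Sum>i\<le>degree p. \<Sum>j\<le>degree q. Re (coeff p i * z ^ i) * Re (coeff q j * z ^ j))"
    by (intro T_sum mono') auto
  then show ?thesis
    unfolding T_def poly_altdef Re_sum sum_product .
qed

lemma real_polynomial_function_circle:
  assumes "real_polynomial_function (g :: complex \<Rightarrow> real)"
  shows "\<exists>p :: complex poly. \<forall>z\<in>sphere 0 1. g z = Re (poly p z)"
  using assms
proof induction
  case (linear f)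
  interpret bounded_linear f by fact
  have "f z = Re (poly [:0, of_real (f 1) - \<i> * of_real (f \<i>):] z)" for z
  proof -
    have "f z = f (Re z *\<^sub>R 1 + Im z *\<^sub>R \<i>)"
      by (metis complex_eq mult.commute scaleR_conv_of_real mult_1)
    also have "\<dots> = Re z * f 1 + Im z * f \<i>"
      unfolding add scaleR by simp
    finally show ?thesis by (simp add: algebra_simps)
  qed
  then show ?case by blast
next
  case (const c)
  show ?case by (intro exI[of _ "[:of_real c:]"]) simp
next
  case (add f g)
  then show ?case by (metis poly_add plus_complex.sel(1))
next
  case (mult f g)
  then show ?case using Re_poly_mult_circle by metis
qed

text \<open>Stone-Weierstrass is applied to \<open>v + e / 2\<close> with tolerance
  \<open>e / 2\<close>, which places the approximant between \<open>v\<close> and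
  \<open>v + e\<close>. Being the real part of a polynomial, it extends harmonically into the
  disc.\<close>

lemma circle_approx_above_Re_poly:
  fixes v :: "complex \<Rightarrow> real"
  assumes "continuous_on (sphere 0 1) v" "e > 0"
  shows "\<exists>p :: complex poly. \<forall>z. cmod z = 1 \<longrightarrow> v z \<le> Re (poly p z) \<and> Re (poly p z) \<le> v z + e"
proof -
  have "\<exists>g. real_polynomial_function g \<and> (\<forall>z\<in>sphere 0 1. \<bar>v z + e / 2 - g z\<bar> < e / 2)"
    by (rule Stone_Weierstrass_real_polynomial_function[of "sphere 0 1" "\<lambda>z. v z + e / 2" "e / 2"])
       (use assms in \<open>auto intro!: continuous_intros\<close>)
  then obtain g where g: "real_polynomial_function g" "\<And>z. z \<in> sphere 0 1 \<Longrightarrow> \<bar>v z + e / 2 - g z\<bar> < e / 2"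
    by blast
  obtain p :: "complex poly" where p: "\<And>z. z \<in> sphere 0 1 \<Longrightarrow> g z = Re (poly p z)"
    using real_polynomial_function_circle[OF g(1)] by blast
  show ?thesis
  proof (intro exI allI impI)
    fix z :: complex assume "cmod z = 1"
    then have "z \<in> sphere 0 1" by simp
    from g(2)[OF this] p[OF this]
    show "v z \<le> Re (poly p z) \<and> Re (poly p z) \<le> v z + e" unfolding abs_less_iff by linarith
  qed
qed

section \<open>Circular means and the Nevanlinna class\<close>

definition circle_mean :: "(complex \<Rightarrow> complex) \<Rightarrow> real \<Rightarrow> real" where
  "circle_mean f r = 1 / (2 * pi) * integral {0..2 * pi} (\<lambda>\<theta>. log_plus (cmod (f (of_real r * cis \<theta>))))"

lemma log_plus_has_circle_integral:
  assumes "f holomorphic_on unit_disc" "0 \<le> r" "r < 1"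
  shows "((\<lambda>\<theta>. log_plus (cmod (f (of_real r * cis \<theta>)))) has_integral 2 * pi * circle_mean f r) {0..2 * pi}"
proof -
  have "continuous_on {0..2 * pi} (\<lambda>\<theta>. log_plus (cmod (f (of_real r * cis \<theta>))))"
    by (intro continuous_on_log_plus_cmod continuous_on_compose2[OF holomorphic_on_imp_continuous_on[OF assms(1)]]
        continuous_intros) (use assms in \<open>auto simp: norm_mult\<close>)
  then show ?thesis
    unfolding circle_mean_def using integrable_continuous_interval by (auto simp: has_integral_integral)
qed

text \<open>Approximating the boundary values by the real part of a polynomial replaces the Poisson extension: no boundary regularity is needed for the maximum principle.\<close>

lemma log_plus_le_Re_poly_on_disc:
  assumes f: "f holomorphic_on unit_disc" and s: "0 \<le> s" "s < 1" and "e > 0"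
  shows "\<exists>p :: complex poly. (\<forall>z. cmod z \<le> 1 \<longrightarrow> log_plus (cmod (f (of_real s * z))) \<le> Re (poly p z)) \<and>
    Re (poly p 0) \<le> circle_mean f s + e"
proof -
  have sz: "of_real s * z \<in> unit_disc" if "z \<in> cball 0 1" for z
  proof -
    have "s * cmod z \<le> s" using that s by (simp add: mult_left_le)
    then show ?thesis using s by (simp add: norm_mult)
  qed
  have hol: "(\<lambda>z. f (of_real s * z)) holomorphic_on cball 0 1"
    by (rule holomorphic_on_compose_gen[OF _ f, unfolded o_def]) (use sz in \<open>auto intro!: holomorphic_intros\<close>)
  have "continuous_on (sphere 0 1) (\<lambda>z. log_plus (cmod (f (of_real s * z))))"
    by (intro continuous_on_log_plus_cmod continuous_on_subset[OF holomorphic_on_imp_continuous_on[OF hol]]) auto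
  then obtain p :: "complex poly" where
    p1: "\<And>z. cmod z = 1 \<Longrightarrow> log_plus (cmod (f (of_real s * z))) \<le> Re (poly p z)" and
    p2: "\<And>z. cmod z = 1 \<Longrightarrow> Re (poly p z) \<le> log_plus (cmod (f (of_real s * z))) + e"
    using circle_approx_above_Re_poly[OF _ \<open>e > 0\<close>] by blast
  have polyhol: "(\<lambda>z. poly p z) holomorphic_on S" for S
    by (intro holomorphic_intros)
  have max_mod: "cmod (F z) \<le> 1" if "F holomorphic_on cball 0 1" "\<And>z. cmod z = 1 \<Longrightarrow> cmod (F z) \<le> 1" "cmod z \<le> 1" for F z
    by (rule maximum_modulus_frontier[of F "cball 0 1"])
       (use that in \<open>auto intro!: holomorphic_on_imp_continuous_on holomorphic_on_subset[OF that(1)]\<close>)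
  show ?thesis
  proof (intro exI conjI allI impI)
    fix z :: complex assume z: "cmod z \<le> 1"
    \<comment> \<open>The maximum modulus principle is used twice: this bound says that
      \<open>Re (poly p z)\<close> is nonnegative, the next one that its exponential dominates the
      modulus of \<open>f\<close>. Together they bound \<open>log_plus\<close>.\<close>
    have "cmod (exp (- poly p z)) \<le> 1"
    proof (rule max_mod[OF _ _ z])
      show "cmod (exp (- poly p u)) \<le> 1" if "cmod u = 1" for u
        using p1[OF that] log_plus_nonneg[of "cmod (f (of_real s * u))"] by simp
    qed (intro holomorphic_intros)
    moreover have "cmod (f (of_real s * z) * exp (- poly p z)) \<le> 1"
    proof (rule max_mod[OF _ _ z])
      show "cmod (f (of_real s * u) * exp (- poly p u)) \<le> 1" if "cmod u = 1" for u
        using p1[OF that] by (simp add: log_plus_le_iff norm_mult norm_divide exp_minus divide_simps)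
    qed (intro holomorphic_intros hol)
    ultimately show "log_plus (cmod (f (of_real s * z))) \<le> Re (poly p z)"
      by (simp add: log_plus_le_iff norm_mult norm_divide exp_minus divide_simps)
  next
    \<comment> \<open>The upper bound \<open>p2\<close> is averaged over the circle, where the mean
      of \<open>Re (poly p z)\<close> is its value at 0.\<close>
    have "2 * pi * Re (poly p 0) \<le> 2 * pi * circle_mean f s + e * (2 * pi)"
    proof (rule has_integral_le)
      show "((\<lambda>t. Re (poly p (cis t))) has_integral 2 * pi * Re (poly p 0)) {0..2 * pi}"
        by (rule Re_mean_value[OF polyhol])
      show "((\<lambda>t. log_plus (cmod (f (of_real s * cis t))) + e) has_integral 2 * pi * circle_mean f s + e * (2 * pi)) {0..2 * pi}"
        using has_integral_const_real[of e 0 "2 * pi"]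
        by (intro has_integral_add log_plus_has_circle_integral f s) (simp add: mult.commute)
    qed (use p2 in auto)
    then have "2 * pi * Re (poly p 0) \<le> 2 * pi * (circle_mean f s + e)"
      by (simp add: algebra_simps)
    then show "Re (poly p 0) \<le> circle_mean f s + e"
      by simp
  qed
qed

text \<open>A polynomial majorant adapted to the circle of radius \<open>s\<close> also dominates on
  radius \<open>r\<close>, and its mean there is its value at 0, which exceeds the mean at
  \<open>s\<close> by at most \<open>e\<close>.\<close>

lemma circle_mean_mono:
  assumes f: "f holomorphic_on unit_disc" and rs: "0 \<le> r" "r < s" "s < 1"
  shows "circle_mean f r \<le> circle_mean f s"
proof (rule field_le_epsilon)
  fix e :: real assume "e > 0"
  obtain p :: "complex poly" where
    p: "\<And>z. cmod z \<le> 1 \<Longrightarrow> log_plus (cmod (f (of_real s * z))) \<le> Re (poly p z)"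
    "Re (poly p 0) \<le> circle_mean f s + e"
    using log_plus_le_Re_poly_on_disc[OF f _ _ \<open>e > 0\<close>, of s] rs by auto
  have "2 * pi * circle_mean f r \<le> 2 * pi * Re (poly p (of_real (r / s) * 0))"
  proof (rule has_integral_le)
    show "((\<lambda>t. Re (poly p (of_real (r / s) * cis t))) has_integral 2 * pi * Re (poly p (of_real (r / s) * 0))) {0..2 * pi}"
      by (rule Re_mean_value) (intro holomorphic_intros)
    show "((\<lambda>\<theta>. log_plus (cmod (f (of_real r * cis \<theta>)))) has_integral 2 * pi * circle_mean f r) {0..2 * pi}"
      using log_plus_has_circle_integral[OF f] rs by simp
    show "log_plus (cmod (f (of_real r * cis t))) \<le> Re (poly p (of_real (r / s) * cis t))" for t
      using p(1)[of "of_real (r / s) * cis t"] rs by (simp add: norm_mult norm_divide)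
  qed
  then show "circle_mean f r \<le> circle_mean f s + e" using p(2) by simp
qed

text \<open>The mean of a harmonic majorant over every centred circle is its value at 0.\<close>

lemma circle_mean_le_majorant:
  assumes f: "f holomorphic_on unit_disc" and h: "h \<in> positive_harmonic"
    and fh: "\<And>z. z \<in> unit_disc \<Longrightarrow> log_plus (cmod (f z)) \<le> h z" and r: "0 \<le> r" "r < 1"
  shows "circle_mean f r \<le> h 0"
proof -
  obtain H where H: "H holomorphic_on unit_disc" "\<And>z. z \<in> unit_disc \<Longrightarrow> h z = Re (H z)"
    using h unfolding positive_harmonic_iff by blast
  have rz: "of_real r * z \<in> unit_disc" if "z \<in> cball 0 1" for z
  proof -
    have "r * cmod z \<le> r" using that r by (simp add: mult_left_le)
    then show ?thesis using r by (simp add: norm_mult)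
  qed
  have "2 * pi * circle_mean f r \<le> 2 * pi * Re (H (of_real r * 0))"
  proof (rule has_integral_le)
    show "((\<lambda>\<theta>. log_plus (cmod (f (of_real r * cis \<theta>)))) has_integral 2 * pi * circle_mean f r) {0..2 * pi}"
      by (rule log_plus_has_circle_integral[OF f r])
    have "(\<lambda>z. H (of_real r * z)) holomorphic_on cball 0 1"
      by (rule holomorphic_on_compose_gen[OF _ H(1), unfolded o_def]) (use rz in \<open>auto intro!: holomorphic_intros\<close>)
    then show "((\<lambda>t. Re (H (of_real r * cis t))) has_integral 2 * pi * Re (H (of_real r * 0))) {0..2 * pi}"
      by (rule Re_mean_value)
    show "log_plus (cmod (f (of_real r * cis t))) \<le> Re (H (of_real r * cis t))" for t
      using fh[OF rz] H(2)[OF rz] by simp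
  qed
  then show ?thesis using H(2)[of 0] by simp
qed

text \<open>Forward, the dilates of \<open>f\<close> have polynomial majorants whose values at 0
  stay bounded, and a normal limit of these majorants dominates \<open>f\<close>. Backward, the
  means increase with the radius and are bounded by \<open>h 0\<close>, so they converge to their
  supremum.\<close>

lemma nevanlinna_class_iff_majorant:
  "f \<in> nevanlinna_class \<longleftrightarrow>
     f holomorphic_on unit_disc \<and> (\<exists>h\<in>positive_harmonic. \<forall>z\<in>unit_disc. log_plus (cmod (f z)) \<le> h z)"
proof (intro iffI conjI; (elim conjE bexE)?)
  assume "f \<in> nevanlinna_class"
  then obtain L where f: "f holomorphic_on unit_disc" and L: "(circle_mean f \<longlongrightarrow> L) (at_left 1)"
    unfolding nevanlinna_class_def circle_mean_def by auto
  show "f holomorphic_on unit_disc" by fact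
  have mean_le: "circle_mean f s \<le> L" if s: "0 \<le> s" "s < 1" for s
  proof (rule tendsto_lowerbound[OF L])
    show "\<forall>\<^sub>F r in at_left 1. circle_mean f s \<le> circle_mean f r"
      unfolding eventually_at_left_field using circle_mean_mono[OF f] s by (intro exI[of _ s]) auto
  qed simp
  define s where "s n = 1 - inverse (real (Suc n))" for n
  have s: "0 \<le> s n" "s n < 1" for n by (auto simp: s_def field_simps)
  have s1: "s \<longlonglongrightarrow> 1"
    unfolding s_def using tendsto_diff[OF tendsto_const LIMSEQ_inverse_real_of_nat, of 1] by simp
  \<comment> \<open>The approximation error is fixed at 1: only a bound at 0 uniform in
    \<open>n\<close> is wanted.\<close>
  have "\<exists>p::complex poly. (\<forall>z. cmod z \<le> 1 \<longrightarrow> log_plus (cmod (f (of_real (s n) * z))) \<le> Re (poly p z))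
      \<and> Re (poly p 0) \<le> L + 1" for n
  proof -
    obtain p :: "complex poly" where
      "\<And>z. cmod z \<le> 1 \<Longrightarrow> log_plus (cmod (f (of_real (s n) * z))) \<le> Re (poly p z)"
      "Re (poly p 0) \<le> circle_mean f (s n) + 1"
      using log_plus_le_Re_poly_on_disc[OF f s zero_less_one, of n] by blast
    then show ?thesis using mean_le[OF s, of n] by (intro exI[of _ p]) auto
  qed
  then obtain p :: "nat \<Rightarrow> complex poly" where
    p: "\<And>n z. cmod z \<le> 1 \<Longrightarrow> log_plus (cmod (f (of_real (s n) * z))) \<le> Re (poly (p n) z)"
    and p0: "\<And>n. Re (poly (p n) 0) \<le> L + 1"
    by metis
  have sz: "of_real (s n) * z \<in> unit_disc" if "z \<in> unit_disc" for z n
  proof -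
    have "s n * cmod z \<le> cmod z" using s[of n] by (simp add: mult_left_le_one_le)
    then show ?thesis using that s[of n] by (simp add: norm_mult)
  qed
  have hol: "(\<lambda>z. f (of_real (s n) * z)) holomorphic_on unit_disc" for n
    by (rule holomorphic_on_compose_gen[OF _ f, unfolded o_def]) (use sz in \<open>auto intro!: holomorphic_intros\<close>)
  have ph: "(\<lambda>z. Re (poly (p n) z)) \<in> positive_harmonic" for n
  proof (rule positive_harmonicI)
    show "(\<lambda>z. poly (p n) z) holomorphic_on unit_disc" by (intro holomorphic_intros)
    show "0 \<le> Re (poly (p n) z)" if "z \<in> unit_disc" for z
      using p[of z n] that log_plus_nonneg[of "cmod (f (of_real (s n) * z))"] by simp
  qed simp
  have bd: "cmod (f (of_real (s n) * z)) \<le> exp (Re (poly (p n) z))" if "z \<in> unit_disc" for n z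
    using p[of z n] that by (simp add: log_plus_le_iff)
  obtain r g k where r: "strict_mono (r :: nat \<Rightarrow> nat)" and k: "k \<in> positive_harmonic"
    and limk: "\<And>z. z \<in> unit_disc \<Longrightarrow> (\<lambda>n. Re (poly (p (r n)) z)) \<longlonglongrightarrow> k z"
    using harmonic_majorants_normal[of "\<lambda>n z. f (of_real (s n) * z)" "\<lambda>n z. Re (poly (p n) z)", OF hol ph bd p0] by blast
  show "\<exists>h\<in>positive_harmonic. \<forall>z\<in>unit_disc. log_plus (cmod (f z)) \<le> h z"
  proof (intro bexI[OF _ k] ballI)
    fix z assume z: "z \<in> unit_disc"
    have "(\<lambda>n. of_real (s (r n)) * z) \<longlonglongrightarrow> of_real 1 * z"
      using LIMSEQ_subseq_LIMSEQ[OF s1 r] by (intro tendsto_intros) (simp add: o_def)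
    then have "(\<lambda>n. f (of_real (s (r n)) * z)) \<longlonglongrightarrow> f z"
      using holomorphic_on_imp_continuous_on[OF f] z sz[OF z]
      unfolding continuous_on_sequentially o_def by auto
    then have "cmod (f z) \<le> exp (k z)"
      by (intro tendsto_le[OF _ tendsto_exp[OF limk[OF z]] tendsto_norm]) (use bd[OF z] in auto)
    then show "log_plus (cmod (f z)) \<le> k z"
      using positive_harmonic_nonneg[OF k z] by (simp add: log_plus_le_iff)
  qed
next
  fix h assume f: "f holomorphic_on unit_disc" and h: "h \<in> positive_harmonic"
    "\<forall>z\<in>unit_disc. log_plus (cmod (f z)) \<le> h z"
  define L where "L = (SUP r\<in>{0..<1}. circle_mean f r)"
  have bdd: "bdd_above (circle_mean f ` {0..<1})"
    using circle_mean_le_majorant[OF f h(1)] h(2) by (intro bdd_aboveI[of _ "h 0"]) auto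
  have "(circle_mean f \<longlongrightarrow> L) (at_left 1)"
  proof (rule order_tendstoI)
    fix a assume "a < L"
    then obtain s where s: "0 \<le> s" "s < 1" "a < circle_mean f s"
      unfolding L_def using less_cSUP_iff[OF _ bdd] by auto
    show "\<forall>\<^sub>F x in at_left 1. a < circle_mean f x"
      unfolding eventually_at_left_field
      using s circle_mean_mono[OF f s(1)] by (intro exI[of _ s]) (auto intro: less_le_trans)
  next
    fix a assume "L < a"
    then show "\<forall>\<^sub>F x in at_left 1. circle_mean f x < a"
      unfolding eventually_at_left_field
      using cSUP_upper[OF _ bdd] unfolding L_def[symmetric]
      by (intro exI[of _ 0]) (auto intro: le_less_trans less_imp_le)
  qed
  then show "f \<in> nevanlinna_class"
    unfolding nevanlinna_class_def circle_mean_def[abs_def] using f by auto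
qed

section \<open>Blaschke factors and balanced partitions\<close>

lemma cmod_blaschke_factor: "cmod (blaschke_factor w z) = cmod (z - w) / cmod (1 - cnj w * z)"
  by (auto simp: blaschke_factor_def norm_mult norm_divide norm_minus_commute)

text \<open>The normalising factor is unimodular, so facts on disc automorphisms transfer to moduli
  of Blaschke factors.\<close>

lemma cmod_blaschke_factor_Moebius: "cmod (blaschke_factor w z) = cmod (Moebius_function 0 w z)"
  by (simp add: cmod_blaschke_factor Moebius_function_simple norm_divide)

text \<open>The two denominators are conjugate to each other. This symmetry is what the partition
  argument requires of its matrix.\<close>

lemma cmod_blaschke_factor_commute: "cmod (blaschke_factor w z) = cmod (blaschke_factor z w)"
proof -
  have "cmod (1 - cnj w * z) = cmod (cnj (1 - cnj w * z))" by (simp only: complex_mod_cnj)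
  then show ?thesis by (simp add: cmod_blaschke_factor norm_minus_commute mult.commute)
qed

lemma one_minus_cnj_mult_nz:
  assumes "cmod w < 1" "cmod z < 1"
  shows "1 - cnj w * z \<noteq> 0"
proof
  assume "1 - cnj w * z = 0"
  then have "cmod w * cmod z = 1"
    by (metis complex_mod_cnj eq_iff_diff_eq_0 norm_mult norm_one)
  moreover have "cmod w * cmod z < 1" using mult_strict_mono'[OF assms] by simp
  ultimately show False by simp
qed

lemma cmod_blaschke_factor_le_1:
  assumes "cmod w < 1" "cmod z < 1"
  shows "cmod (blaschke_factor w z) \<le> 1"
  using less_imp_le[OF Moebius_function_norm_lt_1[OF assms, of 0]] by (simp add: cmod_blaschke_factor_Moebius)

lemma cmod_blaschke_factor_pos:
  assumes "cmod w < 1" "cmod z < 1" "w \<noteq> z"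
  shows "cmod (blaschke_factor w z) > 0"
  using one_minus_cnj_mult_nz[OF assms(1,2)] assms(3) by (simp add: cmod_blaschke_factor)

lemma blaschke_factor_holomorphic: "w \<in> unit_disc \<Longrightarrow> blaschke_factor w holomorphic_on unit_disc"
  unfolding blaschke_factor_def[abs_def] using one_minus_cnj_mult_nz[of w]
  by (cases "w = 0") (auto intro!: holomorphic_intros)

section \<open>Schwarz lemma with finitely many zeros\<close>

text \<open>A disc automorphism moves the zero to 0, where the Schwarz lemma applies. The strict
  bound it asks for is obtained by scaling \<open>G\<close> by \<open>c < 1\<close> and letting
  \<open>c\<close> tend to 1.\<close>

lemma schwarz_pick_zero:
  assumes G: "G holomorphic_on unit_disc" "\<And>z. z \<in> unit_disc \<Longrightarrow> cmod (G z) \<le> 1"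
    and w: "w \<in> unit_disc" "G w = 0" and z: "z \<in> unit_disc"
  shows "cmod (G z) \<le> cmod (Moebius_function 0 w z)"
proof (rule tendsto_le[OF trivial_limit_at_left_real tendsto_const])
  show "((\<lambda>c. c * cmod (G z)) \<longlongrightarrow> cmod (G z)) (at_left (1::real))"
    by (auto intro!: tendsto_eq_intros)
  show "\<forall>\<^sub>F c in at_left 1. c * cmod (G z) \<le> cmod (Moebius_function 0 w z)"
    unfolding eventually_at_left_field
  proof (intro exI[of _ 0] conjI allI impI; (simp; fail)?)
    fix c :: real assume c: "0 < c" "c < 1"
    define F where "F \<zeta> = of_real c * G (Moebius_function 0 (- w) \<zeta>)" for \<zeta>
    have mw: "Moebius_function 0 (- w) \<zeta> \<in> unit_disc" if "cmod \<zeta> < 1" for \<zeta>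
      using Moebius_function_norm_lt_1[of "- w" \<zeta> 0] w that by simp
    have "cmod (F (Moebius_function 0 w z)) \<le> cmod (Moebius_function 0 w z)"
    proof (rule Schwarz_Lemma(1))
      show "F holomorphic_on unit_disc"
        unfolding F_def
        by (intro holomorphic_intros holomorphic_on_compose_gen[OF Moebius_function_holomorphic G(1), unfolded o_def])
           (use w mw in auto)
      show "F 0 = 0" using w by (simp add: F_def Moebius_function_of_zero)
      show "cmod (F \<zeta>) < 1" if "cmod \<zeta> < 1" for \<zeta>
      proof -
        have "cmod (F \<zeta>) \<le> c * 1"
          unfolding F_def norm_mult using c G(2)[OF mw[OF that]] by (intro mult_mono) auto
        then show ?thesis using c by simp
      qed
      show "cmod (Moebius_function 0 w z) < 1"
        using Moebius_function_norm_lt_1[of w z 0] w z by simp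
    qed
    moreover have "Moebius_function 0 (- w) (Moebius_function 0 w z) = z"
      using Moebius_function_compose[of "- w" w z] w z by simp
    ultimately show "c * cmod (G z) \<le> cmod (Moebius_function 0 w z)"
      using c by (simp add: F_def norm_mult)
  qed
qed

text \<open>The quotient has a removable singularity at \<open>w\<close>; it is bounded by 1 off
  \<open>w\<close> by \<open>schwarz_pick_zero\<close> and at \<open>w\<close> by
  continuity.\<close>

lemma schwarz_divide_zero:
  assumes G: "G holomorphic_on unit_disc" "\<And>z. z \<in> unit_disc \<Longrightarrow> cmod (G z) \<le> 1"
    and w: "w \<in> unit_disc" "G w = 0"
  shows "\<exists>K. K holomorphic_on unit_disc \<and> (\<forall>z\<in>unit_disc. cmod (K z) \<le> 1) \<and>
    (\<forall>z\<in>unit_disc. G z = K z * Moebius_function 0 w z)"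
proof -
  define D where "D z = (if z = w then deriv G w else (G z - G w) / (z - w))" for z
  have "D holomorphic_on unit_disc"
    unfolding D_def by (rule pole_lemma[OF G(1)]) (use w in simp)
  define K where "K z = D z * (1 - cnj w * z)" for z
  have K: "K holomorphic_on unit_disc"
    unfolding K_def by (intro holomorphic_intros) fact
  have eq: "G z = K z * Moebius_function 0 w z" if "z \<in> unit_disc" for z
    using one_minus_cnj_mult_nz[of w z] w that by (auto simp: K_def D_def Moebius_function_simple)
  have le: "cmod (K z) \<le> 1" if z: "z \<in> unit_disc" "z \<noteq> w" for z
  proof -
    have "cmod (K z) * cmod (Moebius_function 0 w z) \<le> 1 * cmod (Moebius_function 0 w z)"
      using schwarz_pick_zero[OF G w z(1)] eq[OF z(1)] by (simp add: norm_mult)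
    moreover have "cmod (Moebius_function 0 w z) > 0"
      using cmod_blaschke_factor_pos[of w z] w z by (simp add: cmod_blaschke_factor_Moebius)
    ultimately show ?thesis by (simp only: mult_le_cancel_right_pos)
  qed
  have "cmod (K w) \<le> 1"
  proof (rule tendsto_upperbound)
    have "isCont K w"
      using holomorphic_on_imp_continuous_on[OF K] w continuous_on_eq_continuous_at[OF open_ball] by blast
    then show "((\<lambda>z. cmod (K z)) \<longlongrightarrow> cmod (K w)) (at w)"
      by (intro tendsto_norm) (simp add: isCont_def)
    have "\<forall>\<^sub>F z in at w. z \<in> unit_disc - {w}"
      using eventually_at_in_open[OF open_ball w(1)] .
    then show "\<forall>\<^sub>F z in at w. cmod (K z) \<le> 1"
      by eventually_elim (use le in auto)
  qed simp
  then show ?thesis using K eq le by metis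
qed

text \<open>The zeros are divided out one at a time. The quotient keeps the remaining zeros because
  the Moebius function of \<open>w\<close> is nonzero at the other points of the disc.\<close>

lemma schwarz_finite_zeros:
  assumes "finite F" "F \<subseteq> unit_disc"
    and "G holomorphic_on unit_disc" "\<And>z. z \<in> unit_disc \<Longrightarrow> cmod (G z) \<le> 1"
    and "\<And>w. w \<in> F \<Longrightarrow> G w = 0" "z \<in> unit_disc"
  shows "cmod (G z) \<le> (\<Prod>w\<in>F. cmod (blaschke_factor w z))"
  using assms
proof (induction F arbitrary: G)
  case empty
  then show ?case by simp
next
  case (insert w F)
  obtain K where K: "K holomorphic_on unit_disc" "\<And>z. z \<in> unit_disc \<Longrightarrow> cmod (K z) \<le> 1"
    "\<And>z. z \<in> unit_disc \<Longrightarrow> G z = K z * Moebius_function 0 w z"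
    using schwarz_divide_zero[of G w] insert.prems by auto
  have "K v = 0" if v: "v \<in> F" for v
  proof -
    have "K v * Moebius_function 0 w v = 0" using K(3)[of v] insert.prems v by auto
    moreover have "cmod (Moebius_function 0 w v) > 0"
      unfolding cmod_blaschke_factor_Moebius[symmetric]
      by (rule cmod_blaschke_factor_pos) (use insert.hyps insert.prems(1) v in auto)
    ultimately show ?thesis by simp
  qed
  then have "cmod (K z) \<le> (\<Prod>w\<in>F. cmod (blaschke_factor w z))"
    using insert.IH[of K] K insert.prems by auto
  then have "cmod (K z) * cmod (blaschke_factor w z) \<le> (\<Prod>w\<in>F. cmod (blaschke_factor w z)) * cmod (blaschke_factor w z)"
    by (rule mult_right_mono) simp
  then show ?case
    using insert K(3)[of z] by (simp add: norm_mult cmod_blaschke_factor_Moebius mult.commute)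
qed

section \<open>Convergence of Blaschke products\<close>

text \<open>The numerator of \<open>1 - blaschke_factor v w\<close> factors as
  \<open>(1 - cmod v) * (v + cmod v * w)\<close>. The linear decay in \<open>1 - cmod v\<close> is
  what matches the Blaschke condition.\<close>

lemma one_minus_blaschke_factor_le:
  assumes v: "cmod v < 1" and w: "cmod w < 1"
  shows "cmod (1 - blaschke_factor v w) \<le> 2 / (1 - cmod w) * (1 - cmod v)"
proof (cases "v = 0")
  case True
  have "cmod (1 - w) \<le> 1 + cmod w" using norm_triangle_ineq4[of 1 w] by simp
  also have "\<dots> \<le> 2 / (1 - cmod w)"
    using w by (simp add: field_simps)
  finally show ?thesis using True by (simp add: blaschke_factor_def)
next
  case False
  have nz: "1 - cnj v * w \<noteq> 0" by (rule one_minus_cnj_mult_nz[OF v w])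
  have vv: "v * cnj v = of_real (cmod v) * of_real (cmod v)"
    by (simp add: complex_norm_square[symmetric] power2_eq_square)
  have "1 - blaschke_factor v w = (v * (1 - cnj v * w) - of_real (cmod v) * (v - w)) / (v * (1 - cnj v * w))"
    using False nz by (simp add: blaschke_factor_def field_simps)
  also have "v * (1 - cnj v * w) - of_real (cmod v) * (v - w) = v - v * cnj v * w - of_real (cmod v) * (v - w)"
    by (simp add: algebra_simps)
  also have "\<dots> = of_real (1 - cmod v) * (v + of_real (cmod v) * w)"
    unfolding vv by (simp add: algebra_simps)
  finally have "cmod (1 - blaschke_factor v w) = (1 - cmod v) * (cmod (v + of_real (cmod v) * w) / (cmod v * cmod (1 - cnj v * w)))"
    using v by (simp add: norm_mult norm_divide del: of_real_diff)
  also have "\<dots> \<le> (1 - cmod v) * (2 / (1 - cmod w))"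
  proof (rule mult_left_mono)
    have "cmod (v + of_real (cmod v) * w) \<le> cmod v + cmod v * cmod w"
      using norm_triangle_ineq[of v "of_real (cmod v) * w"] by (simp add: norm_mult)
    also have "\<dots> \<le> cmod v * 2" using w by (simp add: algebra_simps mult_left_le)
    finally have 1: "cmod (v + of_real (cmod v) * w) \<le> cmod v * 2" .
    have "cmod v * cmod w \<le> cmod w" using v by (simp add: mult_left_le_one_le)
    then have 2: "1 - cmod w \<le> cmod (1 - cnj v * w)"
      using norm_triangle_ineq2[of 1 "cnj v * w"] by (simp add: norm_mult)
    have "cmod (v + of_real (cmod v) * w) / (cmod v * cmod (1 - cnj v * w)) \<le> cmod v * 2 / (cmod v * (1 - cmod w))"
      using 1 2 False w by (intro frac_le mult_left_mono) auto
    then show "cmod (v + of_real (cmod v) * w) / (cmod v * cmod (1 - cnj v * w)) \<le> 2 / (1 - cmod w)"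
      using False by simp
  qed (use v in simp)
  finally show ?thesis by (simp add: mult.commute)
qed

text \<open>The principal logarithms of the factors are summable, so the product converges along
  finite subsets to \<open>exp S\<close>, where \<open>S\<close> is their sum, and
  \<open>phi\<close> is minus the real part of \<open>S\<close>. All later arguments use
  \<open>phi\<close> only through this sum over points or through its sign.\<close>

lemma phi_has_sum:
  assumes sub: "\<Lambda> \<subseteq> unit_disc" and sparse: "\<Lambda> sparse_in unit_disc"
    and blaschke: "(\<lambda>z. 1 - cmod z) summable_on \<Lambda>" and w: "w \<in> \<Lambda>"
  shows "((\<lambda>v. - ln (cmod (blaschke_factor v w))) has_sum phi \<Lambda> w) (\<Lambda> - {w})"
proof -
  define E where "E = \<Lambda> - {w}"
  define C where "C = 2 / (1 - cmod w)"
  have w1: "cmod w < 1" using sub w by auto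
  have v1: "cmod v < 1" "v \<noteq> w" if "v \<in> E" for v using sub that by (auto simp: E_def)
  have C: "C > 0" using w1 by (simp add: C_def)
  have nz: "blaschke_factor v w \<noteq> 0" if "v \<in> E" for v
    using cmod_blaschke_factor_pos[of v w] v1[OF that] w1 by auto
  \<comment> \<open>Off \<open>J\<close> the factor is within 1/2 of 1, where \<open>Ln\<close> is
    bounded by twice that distance. \<open>J\<close> is finite because it lies in a compact subset
    of the disc.\<close>
  define J where "J = E \<inter> cball 0 (1 - 1 / (2 * C))"
  have "finite (cball 0 (1 - 1 / (2 * C)) \<inter> \<Lambda>)"
  proof (rule sparse_in_compact_finite[OF sparse_in_subset[OF sparse]])
    have "1 - 1 / (2 * C) < 1" using C by simp
    then show "cball 0 (1 - 1 / (2 * C)) \<subseteq> unit_disc" by (simp add: cball_subset_ball_iff del: diff_less)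
  qed simp
  then have J: "finite J" by (rule finite_subset[rotated]) (auto simp: J_def E_def)
  have "(\<lambda>v. Ln (blaschke_factor v w)) summable_on (E - J)"
  proof (rule abs_summable_summable, rule summable_on_comparison_test)
    show "(\<lambda>v. 2 * (C * (1 - cmod v))) summable_on (E - J)"
      by (intro summable_on_cmult_right summable_on_subset_banach[OF blaschke]) (auto simp: E_def)
    fix v assume v: "v \<in> E - J"
    have "1 - 1 / (2 * C) < cmod v" using v by (auto simp: J_def)
    then have "C * (1 - cmod v) < C * (1 / (2 * C))" using C by (intro mult_strict_left_mono) auto
    then have "C * (1 - cmod v) < 1 / 2" using C by simp
    moreover have "cmod (blaschke_factor v w - 1) \<le> C * (1 - cmod v)"
      using one_minus_blaschke_factor_le[of v w] v1[of v] v w1 unfolding C_def by (simp add: norm_minus_commute)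
    ultimately show "cmod (Ln (blaschke_factor v w)) \<le> 2 * (C * (1 - cmod v))"
      using norm_Ln_le[of "blaschke_factor v w - 1"] by simp
  qed auto
  then have "(\<lambda>v. Ln (blaschke_factor v w)) summable_on ((E - J) \<union> J)"
    by (rule summable_on_Un_disjoint) (use J in auto)
  moreover have "(E - J) \<union> J = E" by (auto simp: J_def)
  ultimately obtain S where S: "((\<lambda>v. Ln (blaschke_factor v w)) has_sum S) E"
    unfolding summable_on_def by auto
  have "((\<lambda>F. exp (\<Sum>v\<in>F. Ln (blaschke_factor v w))) \<longlongrightarrow> exp S) (finite_subsets_at_top E)"
    using S unfolding has_sum_def by (intro tendsto_intros)
  moreover have "\<forall>\<^sub>F F in finite_subsets_at_top E. exp (\<Sum>v\<in>F. Ln (blaschke_factor v w)) = (\<Prod>v\<in>F. blaschke_factor v w)"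
    by (rule eventually_finite_subsets_at_top_weakI) (use nz in \<open>auto simp: exp_sum intro!: prod.cong\<close>)
  ultimately have "((\<lambda>F. \<Prod>v\<in>F. blaschke_factor v w) \<longlongrightarrow> exp S) (finite_subsets_at_top E)"
    by (rule Lim_transform_eventually)
  then have "blaschke_product_except \<Lambda> w w = exp S"
    unfolding blaschke_product_except_def E_def[symmetric] by (intro tendsto_Lim) auto
  then have phi: "phi \<Lambda> w = - Re S"
    using w by (simp add: phi_def ln_inverse)
  have "((\<lambda>v. - Re (Ln (blaschke_factor v w))) has_sum - Re S) E"
    by (intro has_sum_uminusI has_sum_Re S)
  then show ?thesis
    unfolding phi E_def[symmetric] by (rule has_sum_cong[THEN iffD1, rotated]) (use nz in simp)
qed

section \<open>Balanced signs and partitions\<close>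

text \<open>Signs minimising the energy \<open>\<Sum>i\<in>F. \<Sum>j\<in>F. A i j * (s i * s j)\<close>: flipping one sign cannot decrease it.\<close>

lemma balanced_signs_finite:
  fixes A :: "'a \<Rightarrow> 'a \<Rightarrow> real"
  assumes F: "finite F" and sym: "\<And>i j. A i j = A j i" and diag: "\<And>i. A i i = 0"
  shows "\<exists>s. (\<forall>i. s i = 1 \<or> s i = - 1) \<and> (\<forall>i\<in>F. (\<Sum>j\<in>F. A i j * (s i * s j)) \<le> 0)"
proof -
  define En where "En s = (\<Sum>i\<in>F. \<Sum>j\<in>F. A i j * (s i * s j))" for s :: "'a \<Rightarrow> real"
  define P where "P = PiE F (\<lambda>_. {1, - 1 :: real})"
  have finP: "finite P" unfolding P_def using F by (intro finite_PiE) auto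
  have "(\<lambda>i\<in>F. 1) \<in> P" by (auto simp: P_def)
  then obtain s where s: "s \<in> P" "\<And>t. t \<in> P \<Longrightarrow> En s \<le> En t"
    using ex_min_if_finite[of "En ` P"] finP by (auto simp: not_less) 
  \<comment> \<open>By symmetry and the zero diagonal, the index \<open>i\<close> enters the energy
    only through twice its interaction with the others, which changes sign when \<open>t i\<close>
    does.\<close>
  have split: "En t = En' + 2 * (t i * (\<Sum>j\<in>F - {i}. A i j * t j))"
    if "i \<in> F" "En' = (\<Sum>k\<in>F - {i}. \<Sum>j\<in>F - {i}. A k j * (t k * t j))" for t i En'
  proof -
    have *: "(\<Sum>j\<in>F. g j) = g i + (\<Sum>j\<in>F - {i}. g j)" for g :: "'a \<Rightarrow> real"
      using F that(1) by (rule sum.remove)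
    show ?thesis
      unfolding En_def * that(2) by (simp add: diag sum.distrib sum_distrib_left sym[of _ i] mult_ac)
  qed
  have key: "(\<Sum>j\<in>F. A i j * (s i * s j)) \<le> 0" if i: "i \<in> F" for i
  proof -
    define t where "t = s(i := - s i)"
    have "t \<in> P" using s(1) i by (auto simp: P_def t_def PiE_iff extensional_def)
    then have "En s \<le> En t" by (rule s(2))
    also have "En t = (\<Sum>k\<in>F - {i}. \<Sum>j\<in>F - {i}. A k j * (s k * s j)) - 2 * (s i * (\<Sum>j\<in>F - {i}. A i j * s j))"
      using split[OF i, of _ t] by (simp add: t_def)
    also have "En s = (\<Sum>k\<in>F - {i}. \<Sum>j\<in>F - {i}. A k j * (s k * s j)) + 2 * (s i * (\<Sum>j\<in>F - {i}. A i j * s j))"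
      using split[OF i, of _ s] by simp
    finally have "s i * (\<Sum>j\<in>F - {i}. A i j * s j) \<le> 0" by simp
    moreover have "(\<Sum>j\<in>F. A i j * (s i * s j)) = s i * (\<Sum>j\<in>F - {i}. A i j * s j)"
      using sum.remove[OF F i, of "\<lambda>j. A i j * (s i * s j)"] by (simp add: diag sum_distrib_left mult_ac)
    ultimately show ?thesis by simp
  qed
  \<comment> \<open>Members of \<open>P\<close> are undefined outside \<open>F\<close>; the value 1
    there makes every value a sign.\<close>
  define s' where "s' i = (if i \<in> F then s i else 1)" for i
  have "s' i = 1 \<or> s' i = - 1" for i
    using s(1) by (auto simp: s'_def P_def PiE_iff)
  moreover have "(\<Sum>j\<in>F. A i j * (s' i * s' j)) \<le> 0" if "i \<in> F" for i
    using key[OF that] that by (simp add: s'_def)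
  ultimately show ?thesis by blast
qed

text \<open>\<open>F n\<close> collects the points numbered below \<open>n\<close>. Eventual
  containment of each finite subset is the property used when limits are taken, and finite
  \<open>X\<close> is covered as well.\<close>

lemma countable_finite_exhaustion:
  assumes X: "countable X"
  shows "\<exists>F :: nat \<Rightarrow> 'a set. (\<forall>n. finite (F n) \<and> F n \<subseteq> X) \<and>
    (\<forall>G. finite G \<and> G \<subseteq> X \<longrightarrow> (\<exists>N. \<forall>n\<ge>N. G \<subseteq> F n))"
proof -
  define F where "F n = {x \<in> X. to_nat_on X x < n}" for n
  have finF: "finite (F n)" for n
  proof (rule finite_imageD)
    show "finite (to_nat_on X ` F n)" by (rule finite_subset[of _ "{..<n}"]) (auto simp: F_def)
    show "inj_on (to_nat_on X) (F n)" by (rule inj_on_subset[OF inj_on_to_nat_on[OF X]]) (auto simp: F_def)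
  qed
  have subF: "\<exists>N. \<forall>n\<ge>N. G \<subseteq> F n" if G: "finite G" "G \<subseteq> X" for G
  proof -
    obtain N where "\<And>x. x \<in> G \<Longrightarrow> to_nat_on X x < N"
      using finite_nat_set_iff_bounded[of "to_nat_on X ` G"] G by auto
    then show ?thesis using G by (intro exI[of _ N]) (auto simp: F_def intro: less_le_trans)
  qed
  have "F n \<subseteq> X" for n by (auto simp: F_def)
  then show ?thesis using finF subF by (intro exI[of _ F]) blast
qed

text \<open>Balanced signs on a finite exhaustion have a pointwise limit \<open>l\<close> along a
  subsequence. Summability of each row carries the sign inequality to the limit, where it says that
  the part of the row with opposite sign weighs at least as much as the part with equal sign, hence
  at least half of the row.\<close>

lemma balanced_partition:
  fixes A :: "'a \<Rightarrow> 'a \<Rightarrow> real"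
  assumes X: "countable X" and sym: "\<And>i j. A i j = A j i" and diag: "\<And>i. A i i = 0"
    and nonneg: "\<And>i j. i \<in> X \<Longrightarrow> j \<in> X \<Longrightarrow> 0 \<le> A i j"
    and summ: "\<And>i. i \<in> X \<Longrightarrow> A i summable_on X"
  shows "\<exists>S\<subseteq>X. \<forall>i\<in>X. infsum (A i) X \<le> 2 * infsum (A i) (if i \<in> S then X - S else S)"
proof -
  obtain F :: "nat \<Rightarrow> 'a set" where exh: "\<forall>n. finite (F n) \<and> F n \<subseteq> X"
    "\<forall>G. finite G \<and> G \<subseteq> X \<longrightarrow> (\<exists>N. \<forall>n\<ge>N. G \<subseteq> F n)"
    using countable_finite_exhaustion[OF X] by (elim exE conjE) (rule that)
  have F: "finite (F n)" "F n \<subseteq> X" "finite G \<Longrightarrow> G \<subseteq> X \<Longrightarrow> \<exists>N. \<forall>n\<ge>N. G \<subseteq> F n" for n G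
    using exh by auto
  have "\<exists>s. (\<forall>i. s i = 1 \<or> s i = - 1) \<and> (\<forall>i\<in>F n. (\<Sum>j\<in>F n. A i j * (s i * s j)) \<le> 0)" for n
    by (rule balanced_signs_finite[where A = A, OF F(1) sym diag])
  then obtain s where s1: "\<And>n i. s n i = 1 \<or> s n i = (- 1 :: real)"
    and s2: "\<And>n i. i \<in> F n \<Longrightarrow> (\<Sum>j\<in>F n. A i j * (s n i * s n j)) \<le> 0"
    by metis
  \<comment> \<open>A diagonal argument over the countable set \<open>X\<close>; the bounded signs
    converge at every point along one subsequence.\<close>
  have "\<exists>k l. strict_mono (k :: nat \<Rightarrow> nat) \<and> (\<forall>i\<in>X. (\<lambda>n. s (k n) i) \<longlonglongrightarrow> l i)"
  proof (rule function_convergent_subsequence[OF X, of s 1])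
    show "norm (s n i) \<le> 1" for n i using s1[of n i] by auto
    show "\<exists>k l. strict_mono (k :: nat \<Rightarrow> nat) \<and> (\<forall>i\<in>X. (\<lambda>n. s (k n) i) \<longlonglongrightarrow> l i)"
      if "strict_mono k" "\<And>x. x \<in> X \<Longrightarrow> \<exists>l. (\<lambda>n. s (k n) x) \<longlonglongrightarrow> l" for k :: "nat \<Rightarrow> nat"
      using that by (intro exI[of _ k]) metis
  qed
  then obtain k l where k: "strict_mono (k :: nat \<Rightarrow> nat)" and l: "\<And>i. i \<in> X \<Longrightarrow> (\<lambda>n. s (k n) i) \<longlonglongrightarrow> l i"
    by blast
  have l1: "l i = 1 \<or> l i = - 1" if "i \<in> X" for i
  proof -
    have "l i \<in> {1, - 1}"
      by (rule closed_sequentially[OF _ _ l[OF that]]) (use s1 in auto)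
    then show ?thesis by auto
  qed
  define S where "S = {i \<in> X. l i = 1}"
  have "infsum (A i) X \<le> 2 * infsum (A i) (if i \<in> S then X - S else S)" if i: "i \<in> X" for i
  proof -
    define Opp where "Opp = (if i \<in> S then X - S else S)"
    have "j \<in> Opp \<longleftrightarrow> l i * l j = - 1" if "j \<in> X" for j
      using l1[OF i] l1[OF that] that i by (auto simp: Opp_def S_def)
    moreover have "Opp \<subseteq> X" by (auto simp: Opp_def S_def)
    ultimately have Opp: "Opp = {j \<in> X. l i * l j = - 1}" by blast
    have same: "l i * l j = 1" if "j \<in> X - Opp" for j
      using that l1[of i] l1[of j] i by (auto simp: Opp)
    have "infsum (A i) X \<le> 2 * infsum (A i) Opp + e" if "e > 0" for e
    proof -
      define d where "d = e / 2"
      have d: "d > 0" using \<open>e > 0\<close> by (simp add: d_def)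
      have "(sum (A i) \<longlongrightarrow> infsum (A i) X) (finite_subsets_at_top X)"
        using has_sum_infsum[OF summ[OF i]] by (simp add: has_sum_def)
      then have "\<forall>\<^sub>F G in finite_subsets_at_top X. infsum (A i) X - d < sum (A i) G"
        using d by (intro order_tendstoD) auto
      \<comment> \<open>\<open>G\<close> carries all but \<open>d\<close> of the row
        \<open>i\<close>, so whatever the signs outside \<open>G\<close>, those terms lower the
        signed sum by at most \<open>d\<close>.\<close>
      then obtain G where G: "finite G" "G \<subseteq> X" "infsum (A i) X - d < sum (A i) G"
        unfolding eventually_finite_subsets_at_top by blast
      obtain N where N: "\<And>n. n \<ge> N \<Longrightarrow> insert i G \<subseteq> F n"
        using F(3)[of "insert i G"] G i by auto
      have "(\<Sum>j\<in>G. A i j * (s (k n) i * s (k n) j)) \<le> d" if "n \<ge> N" for n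
      proof -
        have kn: "insert i G \<subseteq> F (k n)" using N[of "k n"] seq_suble[OF k, of n] that by simp
        have FX: "F (k n) \<subseteq> X" by (rule F(2))
        have "(\<Sum>j\<in>F (k n). A i j * (s (k n) i * s (k n) j)) \<le> 0"
          using s2 kn by simp
        moreover have "(\<Sum>j\<in>F (k n). A i j * (s (k n) i * s (k n) j)) =
            (\<Sum>j\<in>F (k n) - G. A i j * (s (k n) i * s (k n) j)) + (\<Sum>j\<in>G. A i j * (s (k n) i * s (k n) j))"
          using kn F(1) by (intro sum.subset_diff) auto
        moreover have "- (\<Sum>j\<in>F (k n) - G. A i j) \<le> (\<Sum>j\<in>F (k n) - G. A i j * (s (k n) i * s (k n) j))"
          unfolding sum_negf[symmetric]
        proof (rule sum_mono)
          fix j assume "j \<in> F (k n) - G"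
          then have "0 \<le> A i j" using nonneg i FX by auto
          moreover have "s (k n) i * s (k n) j = 1 \<or> s (k n) i * s (k n) j = - 1"
            using s1[of "k n" i] s1[of "k n" j] by auto
          ultimately show "- A i j \<le> A i j * (s (k n) i * s (k n) j)" by auto
        qed
        moreover have "(\<Sum>j\<in>F (k n). A i j) \<le> infsum (A i) X"
          by (rule finite_sum_le_infsum[OF summ[OF i] F(1) FX]) (use nonneg i in auto)
        moreover have "(\<Sum>j\<in>F (k n). A i j) = (\<Sum>j\<in>F (k n) - G. A i j) + sum (A i) G"
          using kn F(1) by (intro sum.subset_diff) auto
        ultimately show ?thesis using G(3) by linarith
      qed
      then have ev: "\<forall>\<^sub>F n in sequentially. (\<Sum>j\<in>G. A i j * (s (k n) i * s (k n) j)) \<le> d"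
        unfolding eventually_sequentially by blast
      have "(\<lambda>n. \<Sum>j\<in>G. A i j * (s (k n) i * s (k n) j)) \<longlonglongrightarrow> (\<Sum>j\<in>G. A i j * (l i * l j))"
        by (intro tendsto_intros l i) (use G in auto)
      then have 1: "(\<Sum>j\<in>G. A i j * (l i * l j)) \<le> d"
        by (rule tendsto_upperbound[OF _ ev]) simp
      \<comment> \<open>Pointwise, 1 equals \<open>l i * l j\<close> plus 2 if \<open>j\<close> lies
        in \<open>Opp\<close>. One \<open>d\<close> bounds the signed sum and the other the tail
        outside \<open>G\<close>, whence \<open>d = e / 2\<close>.\<close>
      have "sum (A i) G = (\<Sum>j\<in>G. A i j * (l i * l j)) + (\<Sum>j\<in>G. if j \<in> Opp then 2 * A i j else 0)"
        unfolding sum.distrib[symmetric]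
      proof (rule sum.cong[OF refl])
        fix j assume "j \<in> G"
        then show "A i j = A i j * (l i * l j) + (if j \<in> Opp then 2 * A i j else 0)"
          using same[of j] G(2) by (auto simp: Opp)
      qed
      also have "(\<Sum>j\<in>G. if j \<in> Opp then 2 * A i j else 0) = 2 * sum (A i) (G \<inter> Opp)"
        using G(1) by (simp add: sum.inter_restrict sum_distrib_left if_distrib cong: if_cong)
      also have "sum (A i) (G \<inter> Opp) \<le> infsum (A i) Opp"
        by (rule finite_sum_le_infsum[OF summable_on_subset_banach[OF summ[OF i]]])
           (use G nonneg i in \<open>auto simp: Opp\<close>)
      finally show ?thesis using 1 G(3) by (simp add: d_def)
    qed
    then show ?thesis unfolding Opp_def[symmetric] by (rule field_le_epsilon)
  qed
  moreover have "S \<subseteq> X" by (auto simp: S_def)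
  ultimately show ?thesis by blast
qed

section \<open>Interpolation\<close>

lemma log_plus_of_le_exp: "y \<ge> 0 \<Longrightarrow> x \<ge> 0 \<Longrightarrow> x \<le> exp y \<Longrightarrow> log_plus x \<le> y"
  by (simp add: log_plus_le_iff)

lemma nevanlinna_classI:
  assumes "f holomorphic_on unit_disc" "h \<in> positive_harmonic"
    "\<And>z. z \<in> unit_disc \<Longrightarrow> log_plus (cmod (f z)) \<le> h z"
  shows "f \<in> nevanlinna_class"
  unfolding nevanlinna_class_iff_majorant using assms by blast

lemma l_N_I:
  assumes "a \<in> extensional \<Lambda>" "h \<in> positive_harmonic" "\<And>z. z \<in> \<Lambda> \<Longrightarrow> log_plus (cmod (a z)) \<le> h z"
  shows "a \<in> l_N \<Lambda>"
  unfolding l_N_def using assms by blast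

section \<open>The trace space and \<open>l_N\<close>\<close>

lemma trace_nevanlinna_subset_l_N:
  assumes "\<Lambda> \<subseteq> unit_disc"
  shows "trace_space nevanlinna_class \<Lambda> \<subseteq> l_N \<Lambda>"
proof
  fix a assume "a \<in> trace_space nevanlinna_class \<Lambda>"
  then obtain f where f: "f \<in> nevanlinna_class" "a = restrict f \<Lambda>"
    by (auto simp: trace_space_def)
  then obtain h where h: "h \<in> positive_harmonic" "\<forall>z\<in>unit_disc. log_plus (cmod (f z)) \<le> h z"
    by (auto simp: nevanlinna_class_iff_majorant)
  show "a \<in> l_N \<Lambda>"
    by (rule l_N_I[OF _ h(1)]) (use assms f(2) h(2) in auto)
qed

text \<open>A bounded multiplier costs only an additive constant in the majorant, the logarithm of
  \<open>max 1 B\<close>.\<close>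

lemma ideal_space_l_N:
  assumes "\<Lambda> \<subseteq> unit_disc"
  shows "ideal_space \<Lambda> (l_N \<Lambda>)"
  unfolding ideal_space_def
proof (intro ballI allI impI)
  fix a \<omega> :: "complex \<Rightarrow> complex" assume a: "a \<in> l_N \<Lambda>" and "bounded (\<omega> ` \<Lambda>)"
  then obtain B where B: "\<And>z. z \<in> \<Lambda> \<Longrightarrow> cmod (\<omega> z) \<le> B"
    unfolding bounded_iff by auto
  obtain h where h: "h \<in> positive_harmonic" "\<And>z. z \<in> \<Lambda> \<Longrightarrow> log_plus (cmod (a z)) \<le> h z"
    using a by (auto simp: l_N_def)
  define c where "c = ln (max 1 B)"
  have "c \<ge> 0" by (simp add: c_def)
  have k: "(\<lambda>z. c + h z) \<in> positive_harmonic"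
    by (intro positive_harmonic_add positive_harmonic_const h \<open>c \<ge> 0\<close>)
  have "log_plus (cmod (\<omega> z * a z)) \<le> c + h z" if z: "z \<in> \<Lambda>" for z
  proof (rule log_plus_of_le_exp)
    have "cmod (\<omega> z) \<le> exp c" using B[OF z] by (simp add: c_def)
    moreover have "cmod (a z) \<le> exp (h z)" using h(2)[OF z] by (simp add: log_plus_le_iff)
    ultimately show "cmod (\<omega> z * a z) \<le> exp (c + h z)"
      unfolding norm_mult exp_add by (intro mult_mono) auto
    show "0 \<le> c + h z" using positive_harmonic_nonneg[OF k] assms z by auto
  qed simp
  then show "(\<lambda>z\<in>\<Lambda>. \<omega> z * a z) \<in> l_N \<Lambda>"
    by (intro l_N_I[OF _ k]) auto
qed

text \<open>If \<open>Re H\<close> dominates the data, then \<open>exp H\<close> is a zero-free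
  Nevanlinna function and \<open>a\<close> is its restriction times a multiplier bounded by 1, so
  ideality puts \<open>a\<close> in the trace.\<close>

lemma l_N_subset_trace_if_free:
  assumes sub: "\<Lambda> \<subseteq> unit_disc" and free: "free_interpolating nevanlinna_class \<Lambda>"
  shows "l_N \<Lambda> \<subseteq> trace_space nevanlinna_class \<Lambda>"
proof
  fix a assume a: "a \<in> l_N \<Lambda>"
  then obtain h where h: "h \<in> positive_harmonic" "\<And>z. z \<in> \<Lambda> \<Longrightarrow> log_plus (cmod (a z)) \<le> h z"
    by (auto simp: l_N_def)
  then obtain H where H: "H holomorphic_on unit_disc" "\<And>z. z \<in> unit_disc \<Longrightarrow> h z = Re (H z)"
    unfolding positive_harmonic_iff by blast
  define f where "f z = exp (H z)" for z
  have fh: "log_plus (cmod (f z)) \<le> h z" if z: "z \<in> unit_disc" for z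
    using H(2)[OF z] positive_harmonic_nonneg[OF h(1) z] by (intro log_plus_of_le_exp) (auto simp: f_def)
  have "f holomorphic_on unit_disc" unfolding f_def by (intro holomorphic_intros H)
  then have "f \<in> nevanlinna_class"
    by (rule nevanlinna_classI[OF _ h(1) fh])
  then have f: "restrict f \<Lambda> \<in> trace_space nevanlinna_class \<Lambda>"
    by (auto simp: trace_space_def)
  define \<omega> where "\<omega> z = a z / f z" for z
  have "cmod (\<omega> z) \<le> 1" if z: "z \<in> \<Lambda>" for z
  proof -
    have "h z = Re (H z)" using H(2) sub z by auto
    then show ?thesis using h(2)[OF z] by (simp add: \<omega>_def f_def norm_divide log_plus_le_iff)
  qed
  then have "bounded (\<omega> ` \<Lambda>)" unfolding bounded_iff by auto
  then have "(\<lambda>z\<in>\<Lambda>. \<omega> z * restrict f \<Lambda> z) \<in> trace_space nevanlinna_class \<Lambda>"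
    using free f unfolding free_interpolating_def ideal_space_def by blast
  moreover have "(\<lambda>z\<in>\<Lambda>. \<omega> z * restrict f \<Lambda> z) = a"
    using a by (auto simp: l_N_def \<omega>_def f_def extensional_def)
  ultimately show "a \<in> trace_space nevanlinna_class \<Lambda>" by simp
qed

section \<open>From the trace space to a majorant of \<open>phi\<close>\<close>

text \<open>Let \<open>f\<close> interpolate the indicator function of \<open>T\<close>, with
  majorant \<open>Re H\<close>. Then \<open>f z * exp (- H z)\<close> is bounded by 1, vanishes on
  \<open>\<Lambda> - T\<close> and has modulus \<open>exp (- h w)\<close> at \<open>w\<close> in
  \<open>T\<close>, so the Schwarz lemma bounds this number by every finite Blaschke product over
  \<open>\<Lambda> - T\<close>. A single \<open>h\<close> serves all \<open>w\<close> and
  \<open>F\<close>.\<close>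

lemma separating_majorant:
  assumes sub: "\<Lambda> \<subseteq> unit_disc" and tr: "l_N \<Lambda> \<subseteq> trace_space nevanlinna_class \<Lambda>" and T: "T \<subseteq> \<Lambda>"
  shows "\<exists>h\<in>positive_harmonic. \<forall>w\<in>T. \<forall>F. finite F \<and> F \<subseteq> \<Lambda> - T \<longrightarrow>
    (\<Sum>v\<in>F. - ln (cmod (blaschke_factor v w))) \<le> h w"
proof -
  have "(\<lambda>z\<in>\<Lambda>. of_bool (z \<in> T)) \<in> l_N \<Lambda>"
    by (rule l_N_I[OF _ positive_harmonic_const[OF order_refl]]) (auto simp: log_plus_def)
  then obtain f where f: "f \<in> nevanlinna_class" and feq: "(\<lambda>z\<in>\<Lambda>. of_bool (z \<in> T)) = restrict f \<Lambda>"
    using tr by (auto simp: trace_space_def)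
  have fT: "f z = of_bool (z \<in> T)" if "z \<in> \<Lambda>" for z
    using fun_cong[OF feq, of z] that by simp
  obtain h where hf: "f holomorphic_on unit_disc" and h: "h \<in> positive_harmonic"
    and fh: "\<And>z. z \<in> unit_disc \<Longrightarrow> log_plus (cmod (f z)) \<le> h z"
    using f by (auto simp: nevanlinna_class_iff_majorant)
  obtain H where H: "H holomorphic_on unit_disc" "\<And>z. z \<in> unit_disc \<Longrightarrow> h z = Re (H z)"
    using h unfolding positive_harmonic_iff by blast
  define G where "G z = f z * exp (- H z)" for z
  have cG: "cmod (G z) = cmod (f z) * exp (- h z)" if "z \<in> unit_disc" for z
    using H(2)[OF that] by (simp add: G_def norm_mult)
  have "(\<Sum>v\<in>F. - ln (cmod (blaschke_factor v w))) \<le> h w" if w: "w \<in> T" and F: "finite F" "F \<subseteq> \<Lambda> - T" for w F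
  proof -
    have wD: "w \<in> unit_disc" using w T sub by auto
    have pos: "cmod (blaschke_factor v w) > 0" if "v \<in> F" for v
      by (rule cmod_blaschke_factor_pos) (use that F w wD sub in auto)
    have "cmod (G w) \<le> (\<Prod>v\<in>F. cmod (blaschke_factor v w))"
    proof (rule schwarz_finite_zeros[OF F(1) _ _ _ _ wD])
      show "F \<subseteq> unit_disc" using F sub by auto
      show "G holomorphic_on unit_disc" unfolding G_def by (intro holomorphic_intros hf H)
      show "cmod (G z) \<le> 1" if "z \<in> unit_disc" for z
        using fh[OF that] by (simp add: cG[OF that] log_plus_le_iff exp_minus divide_simps)
      show "G v = 0" if "v \<in> F" for v using fT[of v] F that by (auto simp: G_def)
    qed
    moreover have "cmod (G w) = exp (- h w)" using fT[of w] w T by (auto simp: cG[OF wD])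
    ultimately have "ln (exp (- h w)) \<le> ln (\<Prod>v\<in>F. cmod (blaschke_factor v w))"
      using pos by (subst ln_le_cancel_iff) (auto intro!: prod_pos)
    also have "\<dots> = (\<Sum>v\<in>F. ln (cmod (blaschke_factor v w)))"
      using pos F(1) by (intro ln_prod) auto
    finally show ?thesis by (simp add: sum_negf)
  qed
  with h show ?thesis by blast
qed

lemma phi_nonneg:
  assumes "\<Lambda> \<subseteq> unit_disc" "\<Lambda> sparse_in unit_disc" "(\<lambda>z. 1 - cmod z) summable_on \<Lambda>"
  shows "0 \<le> phi \<Lambda> z"
proof (cases "z \<in> \<Lambda>")
  case True
  show ?thesis
  proof (rule has_sum_nonneg[OF phi_has_sum[OF assms True]])
    fix v assume "v \<in> \<Lambda> - {z}"
    then show "0 \<le> - ln (cmod (blaschke_factor v z))"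
      using cmod_blaschke_factor_le_1[of v z] cmod_blaschke_factor_pos[of v z] assms(1) True
      by (auto simp: ln_le_zero_iff subset_iff)
  qed
qed (simp add: phi_def)

text \<open>Under a balanced partition, \<open>phi\<close> at each point is at most twice the sum
  over the opposite class, and that sum is dominated by the majorant separating the two
  classes.\<close>

lemma phi_majorant_if_trace:
  assumes sub: "\<Lambda> \<subseteq> unit_disc" and sparse: "\<Lambda> sparse_in unit_disc"
    and blaschke: "(\<lambda>z. 1 - cmod z) summable_on \<Lambda>" and X: "countable \<Lambda>"
    and tr: "l_N \<Lambda> \<subseteq> trace_space nevanlinna_class \<Lambda>"
  shows "has_positive_harmonic_majorant (phi \<Lambda>)"
proof -
  \<comment> \<open>The zero diagonal lets row sums over all of \<open>\<Lambda>\<close> equal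
    \<open>phi\<close>, as \<open>balanced_partition\<close> expects.\<close>
  define A where "A w v = (if v = w then 0 else - ln (cmod (blaschke_factor v w)))" for w v
  have A: "(A w has_sum phi \<Lambda> w) \<Lambda>" if "w \<in> \<Lambda>" for w
    by (rule has_sum_cong_neutral[THEN iffD1, OF _ _ _ phi_has_sum[OF sub sparse blaschke that]])
       (auto simp: A_def)
  have A0: "0 \<le> A w v" if "w \<in> \<Lambda>" "v \<in> \<Lambda>" for w v
    using cmod_blaschke_factor_le_1[of v w] cmod_blaschke_factor_pos[of v w] sub that
    by (auto simp: A_def ln_le_zero_iff subset_iff)
  have "\<exists>S\<subseteq>\<Lambda>. \<forall>w\<in>\<Lambda>. infsum (A w) \<Lambda> \<le> 2 * infsum (A w) (if w \<in> S then \<Lambda> - S else S)"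
  proof (rule balanced_partition[OF X])
    show "A w v = A v w" for w v
      using cmod_blaschke_factor_commute[of v w] by (auto simp: A_def)
    show "A w summable_on \<Lambda>" if "w \<in> \<Lambda>" for w using A[OF that] by (rule has_sum_imp_summable)
  qed (use A0 in \<open>auto simp: A_def\<close>)
  then obtain S where S: "S \<subseteq> \<Lambda>"
    "\<forall>w\<in>\<Lambda>. infsum (A w) \<Lambda> \<le> 2 * infsum (A w) (if w \<in> S then \<Lambda> - S else S)"
    by (elim exE conjE) (rule that)
  have part: "\<exists>h\<in>positive_harmonic. \<forall>w\<in>T. infsum (A w) (\<Lambda> - T) \<le> h w" if T: "T \<subseteq> \<Lambda>" for T
  proof -
    obtain h where h: "h \<in> positive_harmonic" and
      hF: "\<forall>w\<in>T. \<forall>F. finite F \<and> F \<subseteq> \<Lambda> - T \<longrightarrow> (\<Sum>v\<in>F. - ln (cmod (blaschke_factor v w))) \<le> h w"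
      using separating_majorant[OF sub tr T] by (elim bexE) (rule that)
    have "infsum (A w) (\<Lambda> - T) \<le> h w" if w: "w \<in> T" for w
    proof (rule infsum_le_finite_sums)
      show "A w summable_on (\<Lambda> - T)"
        by (rule summable_on_subset_banach[OF has_sum_imp_summable[OF A]]) (use w T in auto)
      fix F assume F: "finite F" "F \<subseteq> \<Lambda> - T"
      then have "sum (A w) F = (\<Sum>v\<in>F. - ln (cmod (blaschke_factor v w)))"
        using w by (intro sum.cong) (auto simp: A_def)
      then show "sum (A w) F \<le> h w" using bspec[OF hF w] F by simp
    qed
    with h show ?thesis by blast
  qed
  obtain h1 where h1: "h1 \<in> positive_harmonic" "\<And>w. w \<in> S \<Longrightarrow> infsum (A w) (\<Lambda> - S) \<le> h1 w"
    using part[OF S(1)] by blast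
  have "\<Lambda> - (\<Lambda> - S) = S" using S(1) by blast
  then obtain h2 where h2: "h2 \<in> positive_harmonic" "\<And>w. w \<in> \<Lambda> - S \<Longrightarrow> infsum (A w) S \<le> h2 w"
    using part[of "\<Lambda> - S"] by auto
  define h where "h z = 2 * (h1 z + h2 z)" for z
  have h: "h \<in> positive_harmonic"
    unfolding h_def by (intro positive_harmonic_scale positive_harmonic_add h1 h2) simp
  have "phi \<Lambda> z \<le> h z" if z: "z \<in> unit_disc" for z
  proof (cases "z \<in> \<Lambda>")
    case True
    have "phi \<Lambda> z = infsum (A z) \<Lambda>" using infsumI[OF A[OF True]] by simp
    then show ?thesis
      using bspec[OF S(2) True] h1(2)[of z] h2(2)[of z] True
        positive_harmonic_nonneg[OF h1(1) z] positive_harmonic_nonneg[OF h2(1) z]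
      by (cases "z \<in> S") (auto simp: h_def)
  next
    case False
    then show ?thesis using positive_harmonic_nonneg[OF h z] by (simp add: phi_def)
  qed
  with h show ?thesis unfolding has_positive_harmonic_majorant_def by blast
qed

section \<open>From a majorant of \<open>phi\<close> to interpolation\<close>

lemma Re_cayley: "cmod x < 1 \<Longrightarrow> Re ((1 + x) / (1 - x)) = (1 - (cmod x)\<^sup>2) / (cmod (1 - x))\<^sup>2"
proof -
  assume "cmod x < 1"
  have "(1 + x) / (1 - x) = (1 + x) * cnj (1 - x) / of_real ((cmod (1 - x))\<^sup>2)"
    by (subst complex_div_cnj) (simp only: of_real_power)
  then have "Re ((1 + x) / (1 - x)) = Re ((1 + x) * cnj (1 - x)) / (cmod (1 - x))\<^sup>2"
    by (simp only: Re_divide_of_real)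
  also have "Re ((1 + x) * cnj (1 - x)) = 1 - (cmod x)\<^sup>2"
    unfolding cmod_power2 by (simp add: algebra_simps power2_eq_square)
  finally show ?thesis .
qed

lemma cmod_mult_cnj_less_1: "cmod w < 1 \<Longrightarrow> cmod z < 1 \<Longrightarrow> cmod (cnj w * z) < 1"
  using mult_strict_mono'[of "cmod w" 1 "cmod z" 1] by (simp add: norm_mult)

text \<open>A positive harmonic bound for the squared kernels in the interpolation formula. Its
  value at 0 is the sum of \<open>1 - (cmod w)\<^sup>2\<close>, which the Blaschke condition bounds
  uniformly in \<open>F\<close>.\<close>

definition cayley_sum :: "complex set \<Rightarrow> complex \<Rightarrow> real" where
  "cayley_sum F z = (\<Sum>w\<in>F. (1 - (cmod w)\<^sup>2) * Re ((1 + cnj w * z) / (1 - cnj w * z)))"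

lemma cayley_sum_positive_harmonic:
  assumes "finite F" "F \<subseteq> unit_disc"
  shows "cayley_sum F \<in> positive_harmonic"
  unfolding cayley_sum_def[abs_def]
proof (intro positive_harmonic_sum assms positive_harmonic_scale)
  fix w assume "w \<in> F"
  then have w: "cmod w < 1" using assms by auto
  show "(\<lambda>z. Re ((1 + cnj w * z) / (1 - cnj w * z))) \<in> positive_harmonic"
  proof (rule positive_harmonicI)
    show "(\<lambda>z. (1 + cnj w * z) / (1 - cnj w * z)) holomorphic_on unit_disc"
      using one_minus_cnj_mult_nz[OF w] by (auto intro!: holomorphic_intros)
    show "0 \<le> Re ((1 + cnj w * z) / (1 - cnj w * z))" if "z \<in> unit_disc" for z
      using cmod_mult_cnj_less_1[OF w, of z] that by (subst Re_cayley) (auto simp: power_le_one)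
  qed simp
  show "0 \<le> 1 - (cmod w)\<^sup>2" using w by (simp add: power_le_one)
qed

text \<open>The squared kernel makes the bound positive harmonic: \<open>(1 - \<bar>w\<bar>\<^sup>2)\<^sup>2 / \<bar>1 - cnj w * z\<bar>\<^sup>2 \<le> (1 - \<bar>w\<bar>\<^sup>2) * Re ((1 + cnj w * z) / (1 - cnj w * z))\<close>.\<close>

lemma finite_interpolation:
  assumes F: "finite F" "F \<subseteq> unit_disc" and h: "h \<in> positive_harmonic"
    and a: "\<And>w. w \<in> F \<Longrightarrow> cmod (a w) \<le> exp (h w) * (\<Prod>v\<in>F - {w}. cmod (blaschke_factor v w))"
  shows "\<exists>f. f holomorphic_on unit_disc \<and> (\<forall>w\<in>F. f w = a w) \<and>
    (\<forall>z\<in>unit_disc. cmod (f z) \<le> exp (h z + cayley_sum F z))"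
proof -
  obtain H where H: "H holomorphic_on unit_disc" "\<And>z. z \<in> unit_disc \<Longrightarrow> h z = Re (H z)"
    using h unfolding positive_harmonic_iff by blast
  define B where "B w z = (\<Prod>v\<in>F - {w}. blaschke_factor v z)" for w z
  define c where "c w = a w / B w w * exp (- H w)" for w
  \<comment> \<open>At \<open>z = w\<close> the squared kernel is 1 and the exponentials cancel,
    while \<open>B w\<close> vanishes at the other nodes; hence the value \<open>a w\<close>. The
    assumption on \<open>a\<close> says exactly that \<open>c w\<close> has modulus at most
    1.\<close>
  define f where "f z = (\<Sum>w\<in>F. c w * B w z * exp (H z) * (of_real (1 - (cmod w)\<^sup>2) / (1 - cnj w * z))\<^sup>2)" for z
  have F1: "cmod w < 1" if "w \<in> F" for w using F that by auto
  have Bww: "B w w \<noteq> 0" if "w \<in> F" for w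
    unfolding B_def using F(1) cmod_blaschke_factor_pos[OF F1 F1[OF that]] by fastforce
  have Bw0: "B w v = 0" if "v \<in> F" "w \<noteq> v" for w v
    unfolding B_def using F(1) that by (intro prod_zero bexI[of _ v]) (auto simp: blaschke_factor_def)
  have B1: "cmod (B w z) \<le> 1" if "z \<in> unit_disc" for w z
    unfolding B_def prod_norm[symmetric] using that F1 cmod_blaschke_factor_le_1 by (intro prod_le_1) auto
  have c1: "cmod (c w) \<le> 1" if w: "w \<in> F" for w
  proof -
    have "cmod (a w) \<le> exp (h w) * cmod (B w w)"
      using a[OF w] by (simp add: B_def prod_norm)
    moreover have "cmod (B w w) > 0" using Bww[OF w] by simp
    moreover have "h w = Re (H w)" using H(2) F w by auto
    ultimately show ?thesis
      by (simp add: c_def norm_mult norm_divide exp_minus divide_simps mult.commute)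
  qed
  have "f holomorphic_on unit_disc"
    unfolding f_def B_def
    by (intro holomorphic_intros H holomorphic_on_prod)
       (use F1 F one_minus_cnj_mult_nz blaschke_factor_holomorphic in auto)
  moreover have "f v = a v" if v: "v \<in> F" for v
  proof -
    have "f v = c v * B v v * exp (H v) * (of_real (1 - (cmod v)\<^sup>2) / (1 - cnj v * v))\<^sup>2"
      unfolding f_def by (subst sum.remove[OF F(1) v]) (auto intro!: sum.neutral simp: Bw0[OF v])
    moreover have "of_real (1 - (cmod v)\<^sup>2) = 1 - cnj v * v"
      unfolding of_real_diff complex_norm_square by (simp add: mult.commute)
    moreover have "1 - cnj v * v \<noteq> 0" by (rule one_minus_cnj_mult_nz) (use F1 v in auto)
    ultimately show ?thesis using Bww[OF v] by (simp add: c_def exp_minus)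
  qed
  moreover have "cmod (f z) \<le> exp (h z + cayley_sum F z)" if z: "z \<in> unit_disc" for z
  proof -
    have "cmod (f z) \<le> (\<Sum>w\<in>F. exp (h z) * ((1 - (cmod w)\<^sup>2) * Re ((1 + cnj w * z) / (1 - cnj w * z))))"
      unfolding f_def
    proof (rule sum_norm_le)
      fix w assume w: "w \<in> F"
      have w2: "0 \<le> 1 - (cmod w)\<^sup>2" using F1[OF w] by (simp add: power_le_one)
      have x: "cmod (cnj w * z) < 1" using cmod_mult_cnj_less_1 F1[OF w] z by auto
      have "(cmod (cnj w * z))\<^sup>2 \<le> (cmod w)\<^sup>2"
        using z by (intro power_mono) (auto simp: norm_mult mult_left_le)
      then have "(1 - (cmod w)\<^sup>2) / (cmod (1 - cnj w * z))\<^sup>2 \<le> Re ((1 + cnj w * z) / (1 - cnj w * z))"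
        unfolding Re_cayley[OF x] by (intro divide_right_mono) auto
      then have "(1 - (cmod w)\<^sup>2) * ((1 - (cmod w)\<^sup>2) / (cmod (1 - cnj w * z))\<^sup>2)
          \<le> (1 - (cmod w)\<^sup>2) * Re ((1 + cnj w * z) / (1 - cnj w * z))"
        using w2 by (rule mult_left_mono)
      moreover have "cmod ((of_real (1 - (cmod w)\<^sup>2) / (1 - cnj w * z))\<^sup>2)
          = (1 - (cmod w)\<^sup>2) * ((1 - (cmod w)\<^sup>2) / (cmod (1 - cnj w * z))\<^sup>2)"
        unfolding norm_power norm_divide norm_of_real using w2 by (simp add: power2_eq_square)
      moreover have "cmod (c w * B w z * exp (H z)) \<le> 1 * 1 * exp (h z)"
        unfolding norm_mult using c1[OF w] B1[OF z] H(2)[OF z] by (intro mult_mono) auto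
      ultimately show "cmod (c w * B w z * exp (H z) * (of_real (1 - (cmod w)\<^sup>2) / (1 - cnj w * z))\<^sup>2)
          \<le> exp (h z) * ((1 - (cmod w)\<^sup>2) * Re ((1 + cnj w * z) / (1 - cnj w * z)))"
        unfolding norm_mult[of "c w * B w z * exp (H z)"] by (intro mult_mono) auto
    qed
    also have "\<dots> = exp (h z) * cayley_sum F z"
      by (simp add: cayley_sum_def sum_distrib_left)
    also have "\<dots> \<le> exp (h z) * exp (cayley_sum F z)"
      by (intro mult_left_mono) (auto intro: order.trans[OF _ exp_ge_add_one_self])
    finally show ?thesis by (simp add: exp_add)
  qed
  ultimately show ?thesis by blast
qed

text \<open>With \<open>h1\<close> dominating the data and \<open>h2\<close> dominating
  \<open>phi\<close>, the sum \<open>h1 + h2\<close> satisfies the hypothesis of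
  \<open>finite_interpolation\<close> on every finite subset. The resulting majorants are bounded at
  0, so a normal limit interpolates on all of \<open>\<Lambda>\<close>.\<close>

lemma l_N_subset_trace_if_majorant:
  assumes sub: "\<Lambda> \<subseteq> unit_disc" and sparse: "\<Lambda> sparse_in unit_disc"
    and blaschke: "(\<lambda>z. 1 - cmod z) summable_on \<Lambda>" and X: "countable \<Lambda>"
    and maj: "has_positive_harmonic_majorant (phi \<Lambda>)"
  shows "l_N \<Lambda> \<subseteq> trace_space nevanlinna_class \<Lambda>"
proof
  fix a assume aN: "a \<in> l_N \<Lambda>"
  then obtain h1 where h1: "h1 \<in> positive_harmonic" "\<And>w. w \<in> \<Lambda> \<Longrightarrow> log_plus (cmod (a w)) \<le> h1 w"
    by (auto simp: l_N_def)
  obtain h2 where h2: "h2 \<in> positive_harmonic" "\<And>w. w \<in> unit_disc \<Longrightarrow> phi \<Lambda> w \<le> h2 w"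
    using maj by (auto simp: has_positive_harmonic_majorant_def)
  define h where "h z = h1 z + h2 z" for z
  have h: "h \<in> positive_harmonic" unfolding h_def by (intro positive_harmonic_add h1 h2)
  obtain F :: "nat \<Rightarrow> complex set" where exh: "\<forall>n. finite (F n) \<and> F n \<subseteq> \<Lambda>"
    "\<forall>G. finite G \<and> G \<subseteq> \<Lambda> \<longrightarrow> (\<exists>N. \<forall>n\<ge>N. G \<subseteq> F n)"
    using countable_finite_exhaustion[OF X] by (elim exE conjE) (rule that)
  have F: "finite (F n)" "F n \<subseteq> \<Lambda>" "finite G \<Longrightarrow> G \<subseteq> \<Lambda> \<Longrightarrow> \<exists>N. \<forall>n\<ge>N. G \<subseteq> F n" for n G
    using exh by auto
  have FD: "F n \<subseteq> unit_disc" for n using F(2)[of n] sub by blast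
  have bound: "cmod (a w) \<le> exp (h w) * (\<Prod>v\<in>F n - {w}. cmod (blaschke_factor v w))" if w: "w \<in> F n" for w n
  proof -
    have wL: "w \<in> \<Lambda>" using F(2) w by auto
    have wD: "w \<in> unit_disc" using sub wL by auto
    have pos: "cmod (blaschke_factor v w) > 0" if "v \<in> \<Lambda> - {w}" for v
      by (rule cmod_blaschke_factor_pos) (use that wD sub in auto)
    \<comment> \<open>All terms of the series for \<open>phi\<close> are nonnegative, so partial
      sums lie below it: a finite subproduct is at least \<open>exp (- h2 w)\<close>.\<close>
    have "(\<Sum>v\<in>F n - {w}. - ln (cmod (blaschke_factor v w))) \<le> phi \<Lambda> w"
    proof (rule has_sum_mono2[OF has_sum_finite phi_has_sum[OF sub sparse blaschke wL]])
      show "0 \<le> - ln (cmod (blaschke_factor v w))" if "v \<in> \<Lambda> - {w} - (F n - {w})" for v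
        using cmod_blaschke_factor_le_1[of v w] pos[of v] sub wD that by (auto simp: ln_le_zero_iff subset_iff)
    qed (use F in auto)
    also have "(\<Sum>v\<in>F n - {w}. - ln (cmod (blaschke_factor v w))) = - ln (\<Prod>v\<in>F n - {w}. cmod (blaschke_factor v w))"
      using F pos by (subst ln_prod) (auto simp: sum_negf subset_iff)
    finally have "- h2 w \<le> ln (\<Prod>v\<in>F n - {w}. cmod (blaschke_factor v w))"
      using h2(2)[OF wD] by simp
    moreover have "(\<Prod>v\<in>F n - {w}. cmod (blaschke_factor v w)) > 0"
      using F(2) pos by (intro prod_pos) auto
    ultimately have "exp (- h2 w) \<le> (\<Prod>v\<in>F n - {w}. cmod (blaschke_factor v w))"
      by (simp add: ln_ge_iff)
    then have "exp (h w) * exp (- h2 w) \<le> exp (h w) * (\<Prod>v\<in>F n - {w}. cmod (blaschke_factor v w))"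
      by (intro mult_left_mono) auto
    moreover have "exp (h w) * exp (- h2 w) = exp (h1 w)" by (simp add: h_def exp_add exp_minus)
    moreover have "cmod (a w) \<le> exp (h1 w)" using h1(2)[OF wL] by (simp add: log_plus_le_iff)
    ultimately show ?thesis by linarith
  qed
  have "\<exists>f. f holomorphic_on unit_disc \<and> (\<forall>w\<in>F n. f w = a w) \<and>
    (\<forall>z\<in>unit_disc. cmod (f z) \<le> exp (h z + cayley_sum (F n) z))" for n
    by (rule finite_interpolation[OF F(1) FD h bound])
  then obtain f where f: "\<And>n. f n holomorphic_on unit_disc" "\<And>n w. w \<in> F n \<Longrightarrow> f n w = a w"
    "\<And>n z. z \<in> unit_disc \<Longrightarrow> cmod (f n z) \<le> exp (h z + cayley_sum (F n) z)"
    by metis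
  have ph: "(\<lambda>z. h z + cayley_sum (F n) z) \<in> positive_harmonic" for n
    by (intro positive_harmonic_add h cayley_sum_positive_harmonic F FD)
  \<comment> \<open>The Blaschke condition enters here: \<open>1 - (cmod w)\<^sup>2\<close> is at
    most \<open>2 * (1 - cmod w)\<close>, giving a bound independent of \<open>n\<close>.\<close>
  have le: "h 0 + cayley_sum (F n) 0 \<le> h 0 + 2 * infsum (\<lambda>z. 1 - cmod z) \<Lambda>" for n
  proof -
    have "cayley_sum (F n) 0 \<le> (\<Sum>w\<in>F n. 2 * (1 - cmod w))"
      unfolding cayley_sum_def
    proof (rule sum_mono)
      fix w assume "w \<in> F n"
      then have "cmod w < 1" using FD[of n] by auto
      then have "(1 - cmod w) * (1 + cmod w) \<le> (1 - cmod w) * 2" by (intro mult_left_mono) auto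
      then show "(1 - (cmod w)\<^sup>2) * Re ((1 + cnj w * 0) / (1 - cnj w * 0)) \<le> 2 * (1 - cmod w)"
        by (simp add: power2_eq_square algebra_simps)
    qed
    moreover have "(\<Sum>w\<in>F n. 1 - cmod w) \<le> infsum (\<lambda>z. 1 - cmod z) \<Lambda>"
      by (rule finite_sum_le_infsum[OF blaschke F(1,2)]) (use sub in \<open>auto simp: subset_iff less_imp_le\<close>)
    ultimately show ?thesis unfolding sum_distrib_left[symmetric] by linarith
  qed
  obtain r g k where r: "strict_mono (r :: nat \<Rightarrow> nat)" and g: "g holomorphic_on unit_disc"
    and k: "k \<in> positive_harmonic"
    and limg: "\<And>z. z \<in> unit_disc \<Longrightarrow> (\<lambda>n. f (r n) z) \<longlonglongrightarrow> g z"
    and limk: "\<And>z. z \<in> unit_disc \<Longrightarrow> (\<lambda>n. h z + cayley_sum (F (r n)) z) \<longlonglongrightarrow> k z"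
    using harmonic_majorants_normal[of f "\<lambda>n z. h z + cayley_sum (F n) z", OF f(1) ph f(3) le] by blast
  have gk: "log_plus (cmod (g z)) \<le> k z" if z: "z \<in> unit_disc" for z
  proof (rule log_plus_of_le_exp)
    show "cmod (g z) \<le> exp (k z)"
      by (rule tendsto_le[OF _ tendsto_exp[OF limk[OF z]] tendsto_norm[OF limg[OF z]]]) (use f(3)[OF z] in auto)
  qed (use positive_harmonic_nonneg[OF k z] in auto)
  have "g \<in> nevanlinna_class" by (rule nevanlinna_classI[OF g k gk])
  moreover have "a = restrict g \<Lambda>"
  proof (rule extensionalityI[of _ \<Lambda>])
    show "a \<in> extensional \<Lambda>" using aN by (simp add: l_N_def)
    fix w assume w: "w \<in> \<Lambda>"
    obtain N where N: "\<And>n. n \<ge> N \<Longrightarrow> w \<in> F n" using F(3)[of "{w}"] w by auto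
    have "\<forall>\<^sub>F n in sequentially. f (r n) w = a w"
      unfolding eventually_sequentially
      by (intro exI[of _ N]) (auto intro!: f(2) N order.trans[OF _ seq_suble[OF r]])
    then have "(\<lambda>n. f (r n) w) \<longlonglongrightarrow> a w" by (rule tendsto_eventually)
    then have "g w = a w" using limg[of w] w sub LIMSEQ_unique by blast
    then show "a w = restrict g \<Lambda> w" using w by simp
  qed simp
  ultimately show "a \<in> trace_space nevanlinna_class \<Lambda>" by (auto simp: trace_space_def)
qed

section \<open>Duality\<close>

text \<open>The kernel is the real part of the Herglotz kernel
  \<open>(\<zeta> + z) / (\<zeta> - z)\<close>.\<close>

lemma poisson_kernel_positive_harmonic:
  assumes "cmod \<zeta> = 1"
  shows "(\<lambda>z. poisson_kernel z \<zeta>) \<in> positive_harmonic"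
proof (rule positive_harmonicI)
  have nz: "\<zeta> - z \<noteq> 0" if "z \<in> unit_disc" for z using that assms by auto
  show "(\<lambda>z. (\<zeta> + z) / (\<zeta> - z)) holomorphic_on unit_disc"
    using nz by (intro holomorphic_intros)
  show "poisson_kernel z \<zeta> = Re ((\<zeta> + z) / (\<zeta> - z))" for z
  proof -
    have "(\<zeta> + z) / (\<zeta> - z) = (\<zeta> + z) * cnj (\<zeta> - z) / of_real ((cmod (\<zeta> - z))\<^sup>2)"
      by (subst complex_div_cnj) (simp only: of_real_power)
    then have "Re ((\<zeta> + z) / (\<zeta> - z)) = Re ((\<zeta> + z) * cnj (\<zeta> - z)) / (cmod (\<zeta> - z))\<^sup>2"
      by (simp only: Re_divide_of_real)
    also have "Re ((\<zeta> + z) * cnj (\<zeta> - z)) = (cmod \<zeta>)\<^sup>2 - (cmod z)\<^sup>2"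
      unfolding cmod_power2 by (simp add: algebra_simps power2_eq_square)
    finally show ?thesis using assms by (simp add: poisson_kernel_def)
  qed
  show "0 \<le> poisson_kernel z \<zeta>" if "z \<in> unit_disc" for z
    using that by (simp add: poisson_kernel_def power_le_one)
qed

text \<open>The inequality between kernels is integrated against the nonnegative boundary values of
  \<open>h\<close> and evaluated by the Poisson formula. As \<open>h\<close> is given on the open
  disc only, this is done for its dilates, and the radius then tends to 1.\<close>

lemma positive_harmonic_poisson_bound:
  assumes h: "h \<in> positive_harmonic" and F: "finite F" "F \<subseteq> unit_disc"
    and s: "\<And>\<zeta>. cmod \<zeta> = 1 \<Longrightarrow> (\<Sum>w\<in>F. c w * poisson_kernel w \<zeta>) \<le> s"
  shows "(\<Sum>w\<in>F. c w * h w) \<le> s * h 0"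
proof -
  obtain H where H: "H holomorphic_on unit_disc" "\<And>z. z \<in> unit_disc \<Longrightarrow> h z = Re (H z)"
    using h unfolding positive_harmonic_iff by blast
  define r where "r n = 1 - inverse (real (Suc n))" for n
  have r: "0 \<le> r n" "r n < 1" for n by (auto simp: r_def field_simps)
  have r1: "r \<longlonglongrightarrow> 1"
    unfolding r_def using tendsto_diff[OF tendsto_const LIMSEQ_inverse_real_of_nat, of 1] by simp
  have rz: "of_real (r n) * z \<in> unit_disc" if "z \<in> cball 0 1" for z n
  proof -
    have "r n * cmod z \<le> r n" using that r by (simp add: mult_left_le)
    then show ?thesis using r[of n] by (simp add: norm_mult)
  qed
  have le: "(\<Sum>w\<in>F. c w * Re (H (of_real (r n) * w))) \<le> s * h 0" for n
  proof -
    define K where "K z = H (of_real (r n) * z)" for z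
    have K: "K holomorphic_on cball 0 1"
      unfolding K_def
      by (rule holomorphic_on_compose_gen[OF _ H(1), unfolded o_def]) (use rz in \<open>auto intro!: holomorphic_intros\<close>)
    have "(\<Sum>w\<in>F. c w * (2 * pi * Re (K w))) \<le> s * (2 * pi * Re (K 0))"
    proof (rule has_integral_le)
      show "((\<lambda>t. \<Sum>w\<in>F. c w * (poisson_kernel w (cis t) * Re (K (cis t)))) has_integral
          (\<Sum>w\<in>F. c w * (2 * pi * Re (K w)))) {0..2 * pi}"
        by (intro has_integral_sum F has_integral_mult_right Re_poisson_integral K) (use F in auto)
      show "((\<lambda>t. s * Re (K (cis t))) has_integral s * (2 * pi * Re (K 0))) {0..2 * pi}"
        by (intro has_integral_mult_right Re_mean_value K)
      fix t :: real
      have "of_real (r n) * cis t \<in> unit_disc" by (rule rz) simp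
      then have "0 \<le> Re (K (cis t))"
        unfolding K_def using H(2) positive_harmonic_nonneg[OF h] by metis
      then have "(\<Sum>w\<in>F. c w * poisson_kernel w (cis t)) * Re (K (cis t)) \<le> s * Re (K (cis t))"
        by (intro mult_right_mono s) auto
      then show "(\<Sum>w\<in>F. c w * (poisson_kernel w (cis t) * Re (K (cis t)))) \<le> s * Re (K (cis t))"
        by (simp add: sum_distrib_right mult.assoc)
    qed
    also have "(\<Sum>w\<in>F. c w * (2 * pi * Re (K w))) = 2 * pi * (\<Sum>w\<in>F. c w * Re (K w))"
      by (simp add: sum_distrib_left mult_ac)
    also have "s * (2 * pi * Re (K 0)) = 2 * pi * (s * h 0)"
      using H(2)[of 0] by (simp add: K_def)
    finally have "(\<Sum>w\<in>F. c w * Re (K w)) \<le> s * h 0" by simp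
    then show ?thesis by (simp add: K_def)
  qed
  have lim: "(\<lambda>n. Re (H (of_real (r n) * w))) \<longlonglongrightarrow> h w" if w: "w \<in> F" for w
  proof -
    have wD: "w \<in> unit_disc" using w F by auto
    have "(\<lambda>n. of_real (r n) * w) \<longlonglongrightarrow> of_real 1 * w"
      by (intro tendsto_intros r1)
    moreover have "of_real (r n) * w \<in> unit_disc" for n using wD by (intro rz) auto
    ultimately have "(\<lambda>n. H (of_real (r n) * w)) \<longlonglongrightarrow> H w"
      using holomorphic_on_imp_continuous_on[OF H(1)] wD
      unfolding continuous_on_sequentially o_def by auto
    then show ?thesis unfolding H(2)[OF wD] by (rule tendsto_Re)
  qed
  have "(\<lambda>n. \<Sum>w\<in>F. c w * Re (H (of_real (r n) * w))) \<longlonglongrightarrow> (\<Sum>w\<in>F. c w * h w)"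
    by (intro tendsto_intros lim)
  then show ?thesis
    by (rule LIMSEQ_le_const2) (use le in blast)
qed

section \<open>Quadratic minimisation on finite sets\<close>

text \<open>An upper Taylor estimate for the squared positive part, whose derivative is
  \<open>2 * max 0 x\<close>; it supplies the first variation in the minimisation.\<close>

lemma pos_part_square_diff:
  fixes x d :: real
  shows "(max 0 (x - d))\<^sup>2 \<le> (max 0 x)\<^sup>2 - 2 * d * max 0 x + d\<^sup>2"
proof (cases "x \<ge> 0")
  case True
  have "(max 0 (x - d))\<^sup>2 \<le> (x - d)\<^sup>2" by (cases "x - d \<ge> 0") (auto simp: max_def)
  then show ?thesis using True by (simp add: max_def power2_eq_square algebra_simps)
next
  case False
  have "(max 0 (x - d))\<^sup>2 \<le> d\<^sup>2"
  proof (cases "x - d \<ge> 0")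
    case True
    then have "max 0 (x - d) \<le> - d" "0 \<le> max 0 (x - d)" using False by auto
    then have "(max 0 (x - d))\<^sup>2 \<le> (- d)\<^sup>2" by (intro power_mono)
    then show ?thesis by simp
  qed simp
  then show ?thesis using False by simp
qed

text \<open>The residuals \<open>c\<close> of a minimiser \<open>k\<close> serve as weights. Testing
  the variational inequality with \<open>C\<close> times Poisson kernels makes \<open>dual\<close>
  applicable and shows that the sum of \<open>c w * (\<phi> w - k w)\<close> is at most 0; this sum
  is the sum of the squares of \<open>c\<close>, so \<open>k\<close> dominates
  \<open>\<phi>\<close>.\<close>

lemma finite_majorant_duality:
  assumes F: "finite F" "F \<subseteq> unit_disc" and C: "C > 0"
    and dual: "\<And>c s. (\<And>w. w \<in> F \<Longrightarrow> 0 \<le> c w) \<Longrightarrow>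
      (\<And>\<zeta>. cmod \<zeta> = 1 \<Longrightarrow> (\<Sum>w\<in>F. c w * poisson_kernel w \<zeta>) \<le> s) \<Longrightarrow> (\<Sum>w\<in>F. c w * \<phi> w) \<le> C * s"
  shows "\<exists>h\<in>positive_harmonic. h 0 \<le> C \<and> (\<forall>w\<in>F. \<phi> w \<le> h w)"
proof -
  define K where "K = {h \<in> positive_harmonic. h 0 \<le> C}"
  define E where "E h = (\<Sum>w\<in>F. (max 0 (\<phi> w - h w))\<^sup>2)" for h :: "complex \<Rightarrow> real"
  have E0: "0 \<le> E h" for h unfolding E_def by (intro sum_nonneg) auto
  have bdd: "bdd_below (E ` K)" by (intro bdd_belowI[of _ 0]) (use E0 in auto)
  have "(\<lambda>_. 0) \<in> K" using positive_harmonic_const[of 0] C by (simp add: K_def)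
  then have ne: "E ` K \<noteq> {}" by auto
  define m where "m = Inf (E ` K)"
  have m: "m \<le> E h" if "h \<in> K" for h unfolding m_def using bdd that by (intro cInf_lower) auto
  have "\<exists>h\<in>K. E h < m + inverse (real (Suc n))" for n
    using cInf_lessD[OF ne, of "m + inverse (real (Suc n))"] unfolding m_def[symmetric] by auto
  then obtain h where h: "\<And>n. h n \<in> K" "\<And>n. E (h n) < m + inverse (real (Suc n))"
    by metis
  have hph: "h n \<in> positive_harmonic" and h0: "h n 0 \<le> C" for n using h(1)[of n] by (auto simp: K_def)
  \<comment> \<open>The bound \<open>C\<close> at 0 makes a minimising sequence normal; the zero
    functions fill the holomorphic slot of \<open>harmonic_majorants_normal\<close>.\<close>
  have "\<exists>r k. strict_mono (r :: nat \<Rightarrow> nat) \<and> k \<in> positive_harmonic \<and> (\<forall>z\<in>unit_disc. (\<lambda>n. h (r n) z) \<longlonglongrightarrow> k z)"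
    using harmonic_majorants_normal[of "\<lambda>_ _. 0" h, OF _ hph _ h0] by auto
  then obtain r k where r: "strict_mono (r :: nat \<Rightarrow> nat)" and kph: "k \<in> positive_harmonic"
    and lim: "\<forall>z\<in>unit_disc. (\<lambda>n. h (r n) z) \<longlonglongrightarrow> k z"
    by blast
  have k0: "k 0 \<le> C"
    using lim h0 by (intro LIMSEQ_le_const2[of "\<lambda>n. h (r n) 0"]) auto
  have "E k \<le> m"
  proof (rule LIMSEQ_le)
    show "(\<lambda>n. E (h (r n))) \<longlonglongrightarrow> E k"
      unfolding E_def using lim F by (intro tendsto_intros) auto
    show "(\<lambda>n. m + inverse (real (Suc (r n)))) \<longlonglongrightarrow> m"
      using tendsto_add[OF tendsto_const LIMSEQ_subseq_LIMSEQ[OF LIMSEQ_inverse_real_of_nat r], of m]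
      by (simp add: o_def)
  qed (use h(2) less_imp_le in blast)
  define c where "c w = max 0 (\<phi> w - k w)" for w
  have opt: "(\<Sum>w\<in>F. c w * g w) \<le> (\<Sum>w\<in>F. c w * k w)" if g: "g \<in> positive_harmonic" "g 0 \<le> C" for g
  proof -
    define D where "D = (\<Sum>w\<in>F. c w * (g w - k w))"
    define Q where "Q = (\<Sum>w\<in>F. (g w - k w)\<^sup>2)"
    have "2 * D \<le> 0 + t * Q" if t: "0 < t" "t < 1" for t
    \<comment> \<open>Minimality is compared along the segment from \<open>k\<close> to
      \<open>g\<close>, which stays in the convex set \<open>K\<close>; dividing by \<open>t\<close>
      leaves an inequality in which \<open>t\<close> can tend to 0.\<close>
    proof -
      have kt: "(\<lambda>z. (1 - t) * k z + t * g z) \<in> K"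
      proof -
        have "(1 - t) * k 0 + t * g 0 \<le> (1 - t) * C + t * C"
          using t k0 g by (intro add_mono mult_left_mono) auto
        also have "\<dots> = C" by (simp add: algebra_simps)
        finally have "(1 - t) * k 0 + t * g 0 \<le> C" .
        moreover have "(\<lambda>z. (1 - t) * k z + t * g z) \<in> positive_harmonic"
          by (intro positive_harmonic_add positive_harmonic_scale kph g) (use t in auto)
        ultimately show ?thesis unfolding K_def by blast
      qed
      have "E k \<le> E (\<lambda>z. (1 - t) * k z + t * g z)" using m[OF kt] \<open>E k \<le> m\<close> by linarith
      also have "\<dots> \<le> (\<Sum>w\<in>F. (c w)\<^sup>2 - 2 * (t * (g w - k w)) * c w + (t * (g w - k w))\<^sup>2)"
        unfolding E_def
      proof (rule sum_mono)
        fix w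
        have "\<phi> w - ((1 - t) * k w + t * g w) = (\<phi> w - k w) - t * (g w - k w)" by (simp add: algebra_simps)
        then show "(max 0 (\<phi> w - ((1 - t) * k w + t * g w)))\<^sup>2
            \<le> (c w)\<^sup>2 - 2 * (t * (g w - k w)) * c w + (t * (g w - k w))\<^sup>2"
          using pos_part_square_diff[of "\<phi> w - k w" "t * (g w - k w)"] by (simp only: c_def)
      qed
      also have "\<dots> = E k - t * (2 * D) + t * (t * Q)"
        unfolding E_def D_def Q_def c_def[symmetric]
        by (simp add: sum.distrib sum_subtractf sum_distrib_left power_mult_distrib power2_eq_square mult_ac)
      finally have "t * (2 * D) \<le> t * (t * Q)" by linarith
      then show ?thesis using t by simp
    qed
    then have "\<forall>\<^sub>F t in at_right 0. 2 * D \<le> 0 + t * Q"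
      unfolding eventually_at_right_field by (intro exI[of _ 1]) auto
    moreover have "((\<lambda>t. 0 + t * Q) \<longlongrightarrow> 0) (at_right 0)"
      by (auto intro!: tendsto_eq_intros)
    ultimately have "2 * D \<le> 0"
      by (intro tendsto_lowerbound) auto
    then show ?thesis by (simp add: D_def right_diff_distrib sum_subtractf)
  qed
  have "(\<Sum>w\<in>F. c w * \<phi> w) \<le> C * ((\<Sum>w\<in>F. c w * k w) / C)"
  proof (rule dual)
    fix \<zeta> :: complex assume \<zeta>: "cmod \<zeta> = 1"
    \<comment> \<open>\<open>C\<close> times the kernel is an admissible competitor, since the
      kernel takes the value 1 at 0.\<close>
    have "(\<Sum>w\<in>F. c w * (C * poisson_kernel w \<zeta>)) \<le> (\<Sum>w\<in>F. c w * k w)"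
    proof (rule opt)
      show "(\<lambda>w. C * poisson_kernel w \<zeta>) \<in> positive_harmonic"
        using C by (intro positive_harmonic_scale poisson_kernel_positive_harmonic \<zeta>) auto
    qed (simp add: poisson_kernel_def \<zeta>)
    then have "C * (\<Sum>w\<in>F. c w * poisson_kernel w \<zeta>) \<le> (\<Sum>w\<in>F. c w * k w)"
      by (simp add: sum_distrib_left mult_ac)
    then show "(\<Sum>w\<in>F. c w * poisson_kernel w \<zeta>) \<le> (\<Sum>w\<in>F. c w * k w) / C"
      using C by (simp add: field_simps)
  qed (simp add: c_def)
  then have "(\<Sum>w\<in>F. c w * (\<phi> w - k w)) \<le> 0"
    using C by (simp add: right_diff_distrib sum_subtractf)
  moreover have cc: "c w * (\<phi> w - k w) = (c w)\<^sup>2" for w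
    by (auto simp: c_def max_def power2_eq_square)
  ultimately have "(\<Sum>w\<in>F. (c w)\<^sup>2) = 0"
    by (intro antisym sum_nonneg) auto
  then have "\<forall>w\<in>F. \<phi> w \<le> k w"
    using F(1) by (subst (asm) sum_nonneg_eq_0_iff) (auto simp: c_def max_def split: if_splits)
  then show ?thesis using kph k0 by blast
qed

section \<open>The dual inequality on the whole sequence\<close>

text \<open>For a finite supremum, \<open>positive_harmonic_poisson_bound\<close> handles every
  finite partial sum. The constant \<open>h 0 + 1\<close> stays positive even if
  \<open>h 0 = 0\<close>, so the right side is infinite whenever the supremum is.\<close>

lemma dual_bound_if_majorant:
  assumes sub: "\<Lambda> \<subseteq> unit_disc" and h: "h \<in> positive_harmonic" and \<phi>: "\<And>w. w \<in> \<Lambda> \<Longrightarrow> \<phi> w \<le> h w"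
    and c: "\<And>w. w \<in> \<Lambda> \<Longrightarrow> 0 \<le> c w"
  shows "(\<Sum>\<^sub>\<infinity>z\<in>\<Lambda>. ennreal (c z * \<phi> z))
    \<le> ennreal (h 0 + 1) * (SUP \<zeta>\<in>sphere 0 1. \<Sum>\<^sub>\<infinity>z\<in>\<Lambda>. ennreal (c z * poisson_kernel z \<zeta>))"
    (is "_ \<le> _ * ?S")
proof (cases "?S = top")
  case True
  have "ennreal (h 0 + 1) \<noteq> 0"
    using positive_harmonic_nonneg[OF h, of 0] by (simp add: ennreal_eq_0_iff not_le)
  then show ?thesis unfolding True by (simp only: ennreal_mult_top if_False top_greatest)
next
  case False
  then obtain s where s: "?S = ennreal s" "s \<ge> 0"
    by (cases ?S) auto
  have h0: "h 0 \<ge> 0" using positive_harmonic_nonneg[OF h] by simp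
  show ?thesis
  proof (rule infsum_le_finite_sums)
    show "(\<lambda>z. ennreal (c z * \<phi> z)) summable_on \<Lambda>" by (simp add: nonneg_summable_on_complete)
    fix F assume F: "finite F" "F \<subseteq> \<Lambda>"
    have P: "0 \<le> c w * poisson_kernel w \<zeta>" if "w \<in> \<Lambda>" for w \<zeta>
      using c[OF that] sub that by (auto simp: poisson_kernel_def subset_iff power_le_one)
    have "(\<Sum>w\<in>F. c w * poisson_kernel w \<zeta>) \<le> s" if \<zeta>: "cmod \<zeta> = 1" for \<zeta>
    proof -
      have "ennreal (\<Sum>w\<in>F. c w * poisson_kernel w \<zeta>) = (\<Sum>w\<in>F. ennreal (c w * poisson_kernel w \<zeta>))"
        using P F by (intro sum_ennreal[symmetric]) auto
      also have "\<dots> = (\<Sum>\<^sub>\<infinity>w\<in>F. ennreal (c w * poisson_kernel w \<zeta>))" using F by simp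
      also have "\<dots> \<le> (\<Sum>\<^sub>\<infinity>w\<in>\<Lambda>. ennreal (c w * poisson_kernel w \<zeta>))"
        using F by (intro infsum_mono_neutral nonneg_summable_on_complete) auto
      also have "\<dots> \<le> ?S" using \<zeta> by (intro SUP_upper) auto
      finally show ?thesis using s by simp
    qed
    then have *: "(\<Sum>w\<in>F. c w * h w) \<le> s * h 0"
      by (intro positive_harmonic_poisson_bound[OF h F(1)]) (use F sub in auto)
    have "(\<Sum>w\<in>F. ennreal (c w * \<phi> w)) \<le> (\<Sum>w\<in>F. ennreal (c w * h w))"
      using F \<phi> c by (intro sum_mono ennreal_leI mult_left_mono) auto
    also have "\<dots> = ennreal (\<Sum>w\<in>F. c w * h w)"
      using F c positive_harmonic_nonneg[OF h] sub by (intro sum_ennreal) (auto simp: subset_iff)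
    also have "\<dots> \<le> ennreal ((h 0 + 1) * s)"
      using * s by (intro ennreal_leI) (simp add: algebra_simps)
    also have "\<dots> = ennreal (h 0 + 1) * ?S" using h0 s by (simp add: ennreal_mult)
    finally show "(\<Sum>w\<in>F. ennreal (c w * \<phi> w)) \<le> ennreal (h 0 + 1) * ?S" .
  qed
qed

text \<open>Weights supported on a finite set reduce the inequality to
  \<open>finite_majorant_duality\<close>. The finite majorants share the bound \<open>C\<close> at
  0, so a normal limit dominates on all of \<open>\<Lambda>\<close>.\<close>

lemma majorant_if_dual_bound:
  assumes sub: "\<Lambda> \<subseteq> unit_disc" and X: "countable \<Lambda>" and C: "C > 0"
    and \<phi>: "\<And>z. 0 \<le> \<phi> z"
    and dual: "\<And>c. (\<And>w. w \<in> \<Lambda> \<Longrightarrow> 0 \<le> c w) \<Longrightarrow> (\<Sum>\<^sub>\<infinity>z\<in>\<Lambda>. ennreal (c z * \<phi> z))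
      \<le> ennreal C * (SUP \<zeta>\<in>sphere 0 1. \<Sum>\<^sub>\<infinity>z\<in>\<Lambda>. ennreal (c z * poisson_kernel z \<zeta>))"
  shows "\<exists>h\<in>positive_harmonic. \<forall>z\<in>\<Lambda>. \<phi> z \<le> h z"
proof -
  obtain F :: "nat \<Rightarrow> complex set" where exh: "\<forall>n. finite (F n) \<and> F n \<subseteq> \<Lambda>"
    "\<forall>G. finite G \<and> G \<subseteq> \<Lambda> \<longrightarrow> (\<exists>N. \<forall>n\<ge>N. G \<subseteq> F n)"
    using countable_finite_exhaustion[OF X] by (elim exE conjE) (rule that)
  have F: "finite (F n)" "F n \<subseteq> \<Lambda>" "finite G \<Longrightarrow> G \<subseteq> \<Lambda> \<Longrightarrow> \<exists>N. \<forall>n\<ge>N. G \<subseteq> F n" for n G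
    using exh by auto
  have "\<exists>h\<in>positive_harmonic. h 0 \<le> C \<and> (\<forall>w\<in>F n. \<phi> w \<le> h w)" for n
  proof (rule finite_majorant_duality[OF F(1) _ C])
    show "F n \<subseteq> unit_disc" using F(2)[of n] sub by blast
    fix c :: "complex \<Rightarrow> real" and s
    assume c: "\<And>w. w \<in> F n \<Longrightarrow> 0 \<le> c w"
      and s: "\<And>\<zeta>. cmod \<zeta> = 1 \<Longrightarrow> (\<Sum>w\<in>F n. c w * poisson_kernel w \<zeta>) \<le> s"
    define c' where "c' w = (if w \<in> F n then c w else 0)" for w
    have restrict_sum: "(\<Sum>\<^sub>\<infinity>z\<in>\<Lambda>. ennreal (c' z * g z)) = ennreal (\<Sum>w\<in>F n. c w * g w)"
      if "\<And>w. w \<in> F n \<Longrightarrow> 0 \<le> g w" for g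
    proof -
      have "(\<Sum>\<^sub>\<infinity>z\<in>\<Lambda>. ennreal (c' z * g z)) = (\<Sum>\<^sub>\<infinity>z\<in>F n. ennreal (c z * g z))"
        using F(2)[of n] by (intro infsum_cong_neutral) (auto simp: c'_def)
      also have "\<dots> = (\<Sum>z\<in>F n. ennreal (c z * g z))" using F(1) by simp
      also have "\<dots> = ennreal (\<Sum>w\<in>F n. c w * g w)" using c that by (intro sum_ennreal) auto
      finally show ?thesis .
    qed
    have P: "0 \<le> poisson_kernel w \<zeta>" if "w \<in> F n" for w \<zeta>
    proof -
      have "cmod w < 1" using that F(2)[of n] sub by auto
      then show ?thesis by (simp add: poisson_kernel_def power_le_one)
    qed
    \<comment> \<open>Evaluating at the boundary point 1 shows \<open>s\<close> nonnegative, so that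
      \<open>ennreal s\<close> does not truncate it.\<close>
    have "0 \<le> (\<Sum>w\<in>F n. c w * poisson_kernel w 1)" by (intro sum_nonneg mult_nonneg_nonneg c P)
    then have s0: "0 \<le> s" using s[of 1] by simp
    have "(\<Sum>\<^sub>\<infinity>z\<in>\<Lambda>. ennreal (c' z * \<phi> z)) \<le> ennreal C * (SUP \<zeta>\<in>sphere 0 1. \<Sum>\<^sub>\<infinity>z\<in>\<Lambda>. ennreal (c' z * poisson_kernel z \<zeta>))"
      by (rule dual) (simp add: c'_def c)
    also have "\<dots> \<le> ennreal C * ennreal s"
    proof (intro mult_left_mono SUP_least)
      fix \<zeta> :: complex assume "\<zeta> \<in> sphere 0 1"
      then show "(\<Sum>\<^sub>\<infinity>z\<in>\<Lambda>. ennreal (c' z * poisson_kernel z \<zeta>)) \<le> ennreal s"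
        using s[of \<zeta>] by (simp add: restrict_sum P ennreal_leI)
    qed simp
    also have "\<dots> = ennreal (C * s)" using C s0 by (simp add: ennreal_mult)
    finally show "(\<Sum>w\<in>F n. c w * \<phi> w) \<le> C * s" using C s0 by (simp add: restrict_sum \<phi>)
  qed
  then obtain h where h: "\<And>n. h n \<in> positive_harmonic" "\<And>n. h n 0 \<le> C" "\<And>n w. w \<in> F n \<Longrightarrow> \<phi> w \<le> h n w"
    by metis
  have "\<exists>r k. strict_mono (r :: nat \<Rightarrow> nat) \<and> k \<in> positive_harmonic \<and> (\<forall>z\<in>unit_disc. (\<lambda>n. h (r n) z) \<longlonglongrightarrow> k z)"
    using harmonic_majorants_normal[of "\<lambda>_ _. 0" h, OF _ h(1) _ h(2)] by auto
  then obtain r k where r: "strict_mono (r :: nat \<Rightarrow> nat)" and k: "k \<in> positive_harmonic"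
    and lim: "\<forall>z\<in>unit_disc. (\<lambda>n. h (r n) z) \<longlonglongrightarrow> k z"
    by blast
  have "\<phi> w \<le> k w" if w: "w \<in> \<Lambda>" for w
  proof (rule LIMSEQ_le_const)
    show "(\<lambda>n. h (r n) w) \<longlonglongrightarrow> k w" using lim w sub by auto
    obtain N where N: "\<And>n. n \<ge> N \<Longrightarrow> w \<in> F n" using F(3)[of "{w}"] w by auto
    show "\<exists>N. \<forall>n\<ge>N. \<phi> w \<le> h (r n) w"
      by (intro exI[of _ N]) (auto intro!: h(3) N order.trans[OF _ seq_suble[OF r]])
  qed
  then show ?thesis using k by blast
qed

section \<open>Equivalence of the four conditions\<close>

theorem theorem1p2:
  fixes \<Lambda> :: "complex set"
  assumes "\<Lambda> \<subseteq> unit_disc"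
    and "\<Lambda> sparse_in unit_disc"
    and "(\<lambda>z. 1 - cmod z) summable_on \<Lambda>"
  shows "(free_interpolating nevanlinna_class \<Lambda> \<longleftrightarrow>
            trace_space nevanlinna_class \<Lambda> = l_N \<Lambda>) \<and>
         (trace_space nevanlinna_class \<Lambda> = l_N \<Lambda> \<longleftrightarrow>
            has_positive_harmonic_majorant (phi \<Lambda>)) \<and>
         (has_positive_harmonic_majorant (phi \<Lambda>) \<longleftrightarrow>
            (\<exists>C::real. C > 0 \<and>
              (\<forall>c :: complex \<Rightarrow> real. (\<forall>z\<in>\<Lambda>. 0 \<le> c z) \<longrightarrow>
                (\<Sum>\<^sub>\<infinity>z\<in>\<Lambda>. ennreal (c z * phi \<Lambda> z))
                \<le> ennreal C * (SUP \<zeta>\<in>sphere 0 1. \<Sum>\<^sub>\<infinity>z\<in>\<Lambda>. ennreal (c z * poisson_kernel z \<zeta>)))))"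
proof -
  have X: "countable \<Lambda>"
    using sparse_imp_countable[OF open_ball assms(2)] assms(1) by (simp add: Int_absorb1)
  note trace_l_N = trace_nevanlinna_subset_l_N[OF assms(1)]
  have 1: "l_N \<Lambda> \<subseteq> trace_space nevanlinna_class \<Lambda>" if "free_interpolating nevanlinna_class \<Lambda>"
    by (rule l_N_subset_trace_if_free[OF assms(1) that])
  have 2: "free_interpolating nevanlinna_class \<Lambda>" if "trace_space nevanlinna_class \<Lambda> = l_N \<Lambda>"
    using ideal_space_l_N[OF assms(1)] by (simp add: free_interpolating_def that)
  have 3: "has_positive_harmonic_majorant (phi \<Lambda>)" if "l_N \<Lambda> \<subseteq> trace_space nevanlinna_class \<Lambda>"
    by (rule phi_majorant_if_trace[OF assms X that])
  have 4: "l_N \<Lambda> \<subseteq> trace_space nevanlinna_class \<Lambda>" if "has_positive_harmonic_majorant (phi \<Lambda>)"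
    by (rule l_N_subset_trace_if_majorant[OF assms X that])
  have 5: "has_positive_harmonic_majorant (phi \<Lambda>) \<longleftrightarrow>
            (\<exists>C::real. C > 0 \<and>
              (\<forall>c :: complex \<Rightarrow> real. (\<forall>z\<in>\<Lambda>. 0 \<le> c z) \<longrightarrow>
                (\<Sum>\<^sub>\<infinity>z\<in>\<Lambda>. ennreal (c z * phi \<Lambda> z))
                \<le> ennreal C * (SUP \<zeta>\<in>sphere 0 1. \<Sum>\<^sub>\<infinity>z\<in>\<Lambda>. ennreal (c z * poisson_kernel z \<zeta>))))"
    (is "_ \<longleftrightarrow> (\<exists>C. C > 0 \<and> ?dual C)")
  proof
    assume "has_positive_harmonic_majorant (phi \<Lambda>)"
    then obtain h where h: "h \<in> positive_harmonic" "\<forall>z\<in>unit_disc. phi \<Lambda> z \<le> h z"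
      unfolding has_positive_harmonic_majorant_def by (elim bexE) (rule that)
    have "?dual (h 0 + 1)"
    proof (intro allI impI)
      fix c :: "complex \<Rightarrow> real" assume "\<forall>z\<in>\<Lambda>. 0 \<le> c z"
      then show "(\<Sum>\<^sub>\<infinity>z\<in>\<Lambda>. ennreal (c z * phi \<Lambda> z))
          \<le> ennreal (h 0 + 1) * (SUP \<zeta>\<in>sphere 0 1. \<Sum>\<^sub>\<infinity>z\<in>\<Lambda>. ennreal (c z * poisson_kernel z \<zeta>))"
        by (intro dual_bound_if_majorant[OF assms(1) h(1)]) (use h(2) assms(1) in auto)
    qed
    moreover have "h 0 + 1 > 0" using positive_harmonic_nonneg[OF h(1), of 0] by simp
    ultimately show "\<exists>C. C > 0 \<and> ?dual C" by (intro exI conjI)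
  next
    assume "\<exists>C. C > 0 \<and> ?dual C"
    then obtain C where C: "C > 0" "?dual C" by (elim exE conjE) (rule that)
    have "\<exists>h\<in>positive_harmonic. \<forall>z\<in>\<Lambda>. phi \<Lambda> z \<le> h z"
    proof (rule majorant_if_dual_bound[OF assms(1) X C(1) phi_nonneg[OF assms]])
      fix c :: "complex \<Rightarrow> real" assume "\<And>w. w \<in> \<Lambda> \<Longrightarrow> 0 \<le> c w"
      then have "\<forall>z\<in>\<Lambda>. 0 \<le> c z" by (rule ballI)
      from mp[OF spec[OF C(2)] this]
      show "(\<Sum>\<^sub>\<infinity>z\<in>\<Lambda>. ennreal (c z * phi \<Lambda> z))
          \<le> ennreal C * (SUP \<zeta>\<in>sphere 0 1. \<Sum>\<^sub>\<infinity>z\<in>\<Lambda>. ennreal (c z * poisson_kernel z \<zeta>))" .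
    qed
    then obtain h where h: "h \<in> positive_harmonic" "\<forall>z\<in>\<Lambda>. phi \<Lambda> z \<le> h z"
      by (elim bexE) (rule that)
    \<comment> \<open>Off \<open>\<Lambda>\<close> the function \<open>phi\<close> is 0, so
      positivity of \<open>h\<close> extends the bound to the whole disc.\<close>
    have "phi \<Lambda> z \<le> h z" if "z \<in> unit_disc" for z
      using h(2) positive_harmonic_nonneg[OF h(1) that] by (cases "z \<in> \<Lambda>") (auto simp: phi_def)
    then show "has_positive_harmonic_majorant (phi \<Lambda>)"
      unfolding has_positive_harmonic_majorant_def by (intro bexI[OF _ h(1)] ballI)
  qed
  show ?thesis
    using 1 2 3 4 trace_l_N by (intro conjI 5) (blast intro!: subset_antisym)+
qed

end
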